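(* Let $\psi_u$ ($u\in\mathbb{C}$) be the functions determined by the harmonic metrics $h_u$ on $(\mathcal{E}_u,\varphi_u)$, which are solutions of $$\Delta\psi_u=2|z^3+u|\sinh(2\psi_u),$$ and let $\psi$ be the solution for $u=0$, so that $\Delta\psi=2|z^3|\sinh(2\psi)$. Then the family $\{\psi_u\}$ contains a sequence $\{\psi_{u_j}\}$, with $u_j\neq 0$ and $u_j\to0$, that converges to $\psi$ in $C^2$ on $\mathbb{C}^*=\mathbb{C}\setminus\{0\}$, i.e. in $C^2(\Omega)$ for every compact $\Omega\subset\mathbb{C}^*$.
   Context: For $u\in\mathbb{C}$, $\mathcal{E}_u=\mathcal{O}(3/4)\oplus\mathcal{O}(-3/4)$ is a filtered bundle on $(\mathbb{CP}^1,\{\infty\})$, where $\mathcal{O}(\alpha)$ is the filtered line bundle whose sections are filtered by pole order at $\infty$ shifted by $-\alpha$ (so the section $1$ has order $-\alpha$ at $\infty$), and $\varphi_u=\begin{pmatrix}0&z^3+u\\1&0\end{pmatrix}dz$. A harmonic metric is a Hermitian metric $h$ on $\mathcal{E}_u$, smooth over $\mathbb{C}$ and adapted to the filtration at $\infty$ (the growth rate of $|s|_h$ at $\infty$ is the order of $s$), with $F_h+[\varphi_u,\varphi_u^{*_h}]=0$, $F_h$ being the curvature of the Chern connection. It exists and is unique up to a scalar multiple (known theorem). In matrix form the adjoint is computed as $\Phi^{*_h}=h\Phi^\dagger h^{-1}$. The harmonic metric is written $$h_u=\begin{pmatrix}|z^3+u|^{1/2}e^{\psi_u}&0\\0&|z^3+u|^{-1/2}e^{-\psi_u}\end{pmatrix}$$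 with $\psi_u$ a real-valued function defined on $\mathbb{C}$ minus the zeros of $z^3+u$; $\psi:=\psi_0$. $\Delta=4\frac{\partial^2}{\partial z\,\partial\bar z}$. For a given compact $\Omega\subset\mathbb{C}^*$, $\psi_{u_j}$ is defined on $\Omega$ once $|u_j|$ is small enough.
   Formalization: With F_h+[φ,φ*]=0 the equation is Δψ_u=8|z³+u|sinh(2ψ_u), not with factor 2; the claim is proved for F_h+κ[φ,φ*]=0 with κ=1 (factor 8) and with κ=1/4 (factor 2 as displayed). *)

theory Defs
  imports "HOL-Complex_Analysis.Complex_Analysis" "HOL-Library.Landau_Symbols"
begin

section \<open>Real and complex differential calculus on the plane\<close>

definition dx :: "(complex \<Rightarrow> 'a::real_normed_vector) \<Rightarrow> complex \<Rightarrow> 'a" where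
  "dx f z = frechet_derivative f (at z) 1"

definition dy :: "(complex \<Rightarrow> 'a::real_normed_vector) \<Rightarrow> complex \<Rightarrow> 'a" where
  "dy f z = frechet_derivative f (at z) \<i>"

text \<open>Real differentiability of class \<open>C\<^sup>k\<close>; only used for open \<open>U\<close>.\<close>

primrec Ck_on :: "nat \<Rightarrow> (complex \<Rightarrow> 'a::real_normed_vector) \<Rightarrow> complex set \<Rightarrow> bool" where
  "Ck_on 0 f U \<longleftrightarrow> continuous_on U f"
| "Ck_on (Suc k) f U \<longleftrightarrow>
     (\<forall>z\<in>U. f differentiable (at z)) \<and> Ck_on k (dx f) U \<and> Ck_on k (dy f) U"

definition d_z :: "(complex \<Rightarrow> complex) \<Rightarrow> complex \<Rightarrow> complex" where
  "d_z f z = (dx f z - \<i> * dy f z) / 2"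

definition d_zbar :: "(complex \<Rightarrow> complex) \<Rightarrow> complex \<Rightarrow> complex" where
  "d_zbar f z = (dx f z + \<i> * dy f z) / 2"

definition laplacian :: "(complex \<Rightarrow> complex) \<Rightarrow> complex \<Rightarrow> complex" where
  "laplacian f z = 4 * d_z (d_zbar f) z"

text \<open>For compact \<open>\<Omega>\<close>, the members of the sequence are allowed to have singularities in \<open>\<Omega>\<close> for
  finitely many indices.\<close>

definition C2_near :: "complex set \<Rightarrow> (complex \<Rightarrow> real) \<Rightarrow> bool" where
  "C2_near \<Omega> f \<longleftrightarrow> (\<exists>U. open U \<and> \<Omega> \<subseteq> U \<and> Ck_on 2 f U)"

definition C2_converges :: "complex set \<Rightarrow> (nat \<Rightarrow> complex \<Rightarrow> real) \<Rightarrow> (complex \<Rightarrow> real) \<Rightarrow> bool" where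
  "C2_converges \<Omega> f g \<longleftrightarrow>
     C2_near \<Omega> g \<and> (\<forall>\<^sub>F j in sequentially. C2_near \<Omega> (f j)) \<and>
     (\<forall>D \<in> {id, dx, dy, dx \<circ> dx, dx \<circ> dy, dy \<circ> dx, dy \<circ> dy}.
        uniform_limit \<Omega> (\<lambda>j. D (f j)) (D g) sequentially)"


section \<open>Hermitian metrics on the trivial bundle of rank two over the plane\<close>

definition mat2 :: "complex \<Rightarrow> complex \<Rightarrow> complex \<Rightarrow> complex \<Rightarrow> complex^2^2" where
  "mat2 a b c d = vector [vector [a, b], vector [c, d]]"

definition dagger :: "complex^2^2 \<Rightarrow> complex^2^2" where
  "dagger A = (\<chi> i j. cnj (A $ j $ i))"

definition sesq :: "complex^2^2 \<Rightarrow> complex^2 \<Rightarrow> complex^2 \<Rightarrow> complex" where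
  "sesq H s t = (\<Sum>i\<in>UNIV. \<Sum>j\<in>UNIV. cnj (t $ i) * H $ i $ j * s $ j)"

definition pos_def_hermitian :: "complex^2^2 \<Rightarrow> bool" where
  "pos_def_hermitian H \<longleftrightarrow> dagger H = H \<and> (\<forall>v. v \<noteq> 0 \<longrightarrow> Re (sesq H v v) > 0)"

text \<open>The metric is represented by a matrix \<open>h\<close> for which the adjoint of \<open>\<Phi>\<close> is
  \<open>h \<Phi>\<^sup>\<dagger> h\<^sup>-\<^sup>1\<close>. This convention means that the Gram matrix in the standard frame \<open>e\<^sub>1, e\<^sub>2\<close> is
  \<open>h\<^sup>-\<^sup>1\<close>, i.e. the inner product of \<open>s\<close> and \<open>t\<close> is \<open>t\<^sup>\<dagger> h\<^sup>-\<^sup>1 s\<close>; see \<open>sesq_adjoint\<close>. It agrees with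
  the weights: for \<open>h = diag (a, 1/a)\<close> with \<open>a\<close> of size \<open>|z|\<^sup>3\<^sup>/\<^sup>2\<close> one gets \<open>|e\<^sub>1|\<close> of size
  \<open>|z|\<^sup>-\<^sup>3\<^sup>/\<^sup>4\<close>.\<close>

definition gram :: "(complex \<Rightarrow> complex^2^2) \<Rightarrow> complex \<Rightarrow> complex^2^2" where
  "gram h z = matrix_inv (h z)"

definition metric_norm :: "(complex \<Rightarrow> complex^2^2) \<Rightarrow> (complex \<Rightarrow> complex^2) \<Rightarrow> complex \<Rightarrow> real" where
  "metric_norm h s z = sqrt (Re (sesq (gram h z) (s z) (s z)))"

definition smooth_hermitian_metric :: "(complex \<Rightarrow> complex^2^2) \<Rightarrow> bool" where
  "smooth_hermitian_metric h \<longleftrightarrow>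
     (\<forall>z. pos_def_hermitian (h z)) \<and> (\<forall>k. Ck_on k h UNIV)"

definition adjoint_wrt :: "complex^2^2 \<Rightarrow> complex^2^2 \<Rightarrow> complex^2^2" where
  "adjoint_wrt H \<Phi> = H ** dagger \<Phi> ** matrix_inv H"

lemma sesq_adjoint:
  assumes "invertible H" "dagger H = H"
  shows "sesq (matrix_inv H) (\<Phi> *v s) t = sesq (matrix_inv H) s (adjoint_wrt H \<Phi> *v t)"
proof -
  define G where "G = matrix_inv H"
  have HG: "H ** G = mat 1" "G ** H = mat 1"
    using assms(1) someI_ex[of "\<lambda>A'. H ** A' = mat 1 \<and> A' ** H = mat 1"]
    unfolding G_def matrix_inv_def invertible_def by blast+
  have dagger_mult: "dagger (A ** B) = dagger B ** dagger A" for A B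
    by (simp add: dagger_def matrix_matrix_mult_def vec_eq_iff mult.commute)
  have dagger_dagger: "dagger (dagger A) = A" for A
    by (simp add: dagger_def vec_eq_iff)
  have dagger_one: "dagger (mat 1) = mat 1"
    by (auto simp: dagger_def mat_def vec_eq_iff)
  have "dagger G ** H = mat 1"
    using arg_cong[OF HG(1), of dagger] by (simp add: dagger_mult dagger_one assms(2))
  then have G: "dagger G = G"
    by (metis HG(1) matrix_mul_assoc matrix_mul_lid matrix_mul_rid)
  have shift: "sesq (A ** B) x y = sesq B x (dagger A *v y)" for A B x y
    by (simp add: sesq_def dagger_def matrix_matrix_mult_def matrix_vector_mult_def sum_2
        algebra_simps)
  have move: "sesq A (B *v x) y = sesq (A ** B) x y" for A B x y
    by (simp add: sesq_def matrix_matrix_mult_def matrix_vector_mult_def sum_2 algebra_simps)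
  have "sesq G s (adjoint_wrt H \<Phi> *v t) = sesq (dagger (H ** dagger \<Phi> ** G) ** G) s t"
    by (simp add: shift dagger_dagger adjoint_wrt_def G_def)
  also have "dagger (H ** dagger \<Phi> ** G) ** G = G ** \<Phi> ** (H ** G)"
    by (simp add: dagger_mult dagger_dagger G assms(2) matrix_mul_assoc)
  also have "\<dots> = G ** \<Phi>"
    by (simp add: HG)
  finally show ?thesis
    by (simp add: move G_def)
qed

text \<open>Chern connection of the Gram matrix \<open>G\<close>: its connection form is \<open>G\<^sup>-\<^sup>1 \<partial>G = A dz\<close>, and its
  curvature is the (0,1)-derivative of \<open>A dz\<close>, which is \<open>- (\<partial>A/\<partial>zbar) dz \<and> dzbar\<close>. For a Higgs field \<open>\<Phi> dz\<close>, the bracket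
  with its adjoint is \<open>(\<Phi> \<Phi>\<^sup>* - \<Phi>\<^sup>* \<Phi>) dz \<and> dzbar\<close>. Both are given by their coefficients
  with respect to \<open>dz \<and> dzbar\<close>.\<close>

definition chern_form :: "(complex \<Rightarrow> complex^2^2) \<Rightarrow> complex \<Rightarrow> complex^2^2" where
  "chern_form h z = matrix_inv (gram h z) ** (\<chi> i j. d_z (\<lambda>w. gram h w $ i $ j) z)"

definition curvature :: "(complex \<Rightarrow> complex^2^2) \<Rightarrow> complex \<Rightarrow> complex^2^2" where
  "curvature h z = (\<chi> i j. - d_zbar (\<lambda>w. chern_form h w $ i $ j) z)"

definition higgs_bracket ::
    "(complex \<Rightarrow> complex^2^2) \<Rightarrow> (complex \<Rightarrow> complex^2^2) \<Rightarrow> complex \<Rightarrow> complex^2^2" where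
  "higgs_bracket h \<Phi> z =
     \<Phi> z ** adjoint_wrt (h z) (\<Phi> z) - adjoint_wrt (h z) (\<Phi> z) ** \<Phi> z"


section \<open>Filtered bundles on the projective line, harmonic metrics\<close>

definition meromorphic_at_infinity :: "(complex \<Rightarrow> complex) \<Rightarrow> bool" where
  "meromorphic_at_infinity f \<longleftrightarrow> (\<lambda>w. f (1 / w)) meromorphic_on {0}"

definition pole_order_at_infinity :: "(complex \<Rightarrow> complex) \<Rightarrow> ereal" where
  "pole_order_at_infinity f =
     (if \<forall>\<^sub>F z in at_infinity. f z = 0 then -\<infinity>
      else ereal (- real_of_int (zorder (\<lambda>w. f (1 / w)) 0)))"

text \<open>The order at infinity of a section of \<open>O(\<alpha>\<^sub>1) \<oplus> O(\<alpha>\<^sub>2)\<close>.\<close>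

definition filtered_order :: "real^2 \<Rightarrow> (complex \<Rightarrow> complex^2) \<Rightarrow> ereal" where
  "filtered_order \<alpha> s = (MAX i\<in>UNIV. pole_order_at_infinity (\<lambda>z. s z $ i) - ereal (\<alpha> $ i))"

definition growth_rate :: "(complex \<Rightarrow> real) \<Rightarrow> ereal" where
  "growth_rate f = Inf {ereal b | b. f \<in> O[at_infinity](\<lambda>z. norm z powr b)}"

definition adapted :: "real^2 \<Rightarrow> (complex \<Rightarrow> complex^2^2) \<Rightarrow> bool" where
  "adapted \<alpha> h \<longleftrightarrow>
     (\<forall>s. (\<forall>i. meromorphic_at_infinity (\<lambda>z. s z $ i)) \<longrightarrow>
        growth_rate (metric_norm h s) = filtered_order \<alpha> s)"

text \<open>For \<open>\<kappa> = 1\<close> this is Hitchin's equation \<open>F\<^sub>h + [\<phi>, \<phi>\<^sup>*] = 0\<close>. The factor \<open>\<kappa>\<close>, equivalent to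
  replacing \<open>\<phi>\<close> by \<open>\<surd>\<kappa> \<phi>\<close>, accounts for a discrepancy of normalisations: for
  \<open>h = diag (|P|\<^sup>1\<^sup>/\<^sup>2 e\<^sup>\<psi>, |P|\<^sup>-\<^sup>1\<^sup>/\<^sup>2 e\<^sup>-\<^sup>\<psi>)\<close>, \<open>P = z\<^sup>3 + u\<close>, the first diagonal entry of the equation
  is \<open>\<Delta>\<psi> / 4 - 2 \<kappa> |P| sinh (2 \<psi>) = 0\<close> with \<open>\<Delta> = 4 \<partial>\<^sup>2/\<partial>z \<partial>zbar\<close>. So \<open>\<kappa> = 1\<close> yields
  \<open>\<Delta>\<psi> = 8 |P| sinh (2 \<psi>)\<close>, whereas \<open>\<Delta>\<psi> = 2 |P| sinh (2 \<psi>)\<close> is the case \<open>\<kappa> = 1/4\<close>.\<close>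

definition harmonic_metric ::
    "real \<Rightarrow> real^2 \<Rightarrow> (complex \<Rightarrow> complex^2^2) \<Rightarrow> (complex \<Rightarrow> complex^2^2) \<Rightarrow> bool" where
  "harmonic_metric \<kappa> \<alpha> \<Phi> h \<longleftrightarrow>
     smooth_hermitian_metric h \<and> adapted \<alpha> h \<and>
     (\<forall>z. curvature h z + \<kappa> *\<^sub>R higgs_bracket h \<Phi> z = 0)"

definition weights :: "real^2" where
  "weights = vector [3/4, -3/4]"

definition higgs_field :: "complex \<Rightarrow> complex \<Rightarrow> complex^2^2" where
  "higgs_field u z = mat2 0 (z^3 + u) 1 0"

end

(* With P = z^3 + u, the function W_u = ln h_11 = psi_u + 1/2 ln |P| is smooth across the zeros of P
   and satisfies Lap W_u = 4 kappa (exp (2 W_u) - |P|^2 exp (- 2 W_u)) on the whole plane, while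
   adaptedness says W_u = 3/2 ln |z| + o(ln |z|).  For small u, W_0 + delta is a supersolution and
   W_0 - delta a subsolution of the equation for u; as functions that are o(ln |z|) obey a comparison
   principle on the plane, |W_u - W_0| <= delta everywhere.  Locally uniform convergence is then
   upgraded to C^2 by applying the interior gradient estimate for the Poisson equation first to
   W_u - W_0 and then to its first derivatives, and ln |P| converges in C^2 away from 0. *)
theory Submission
  imports Defs
begin

section \<open>Differential calculus of class \<open>C\<^sup>k\<close>\<close>

text \<open>The functions \<open>\<psi> u\<close> cannot be compared directly: their logarithmic
  singularities sit at the zeros of z^3 + u, which move with u and run into 0. Passing to W_u trades
  them for the perturbation |z^3 + u|^2 - |z^3|^2, which is unbounded in z. A shift by \<delta>
  copes with it because it gains a factor: with t = exp (2 \<delta>), the squares have to be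
  compared only up to the factor t, and the bound |u| on the difference of the moduli then leaves a
  bounded error. This error is absorbed by a multiple of exp (4 W_0), which is bounded below by a
  positive constant since W_0 grows at infinity. Adaptedness controls W_u only up to o(ln |z|), so
  W_u - W_0 is not known beforehand to be bounded; this is exactly the growth that the harmonic
  function ln |z| beats. The resulting estimate is quantitative, so the family itself converges and
  no subsequence is extracted. The right-hand side of the equation is a smooth function of u, z and
  W, so Laplacians converge as soon as W does, and a gradient bound by sup norms of a function and
  of its Laplacian suffices for C^2.\<close>

lemma dx_dy_eq:
  assumes "(f has_derivative F) (at z)"
  shows "dx f z = F 1" "dy f z = F \<i>"
  using frechet_derivative_at[OF assms] by (simp_all add: dx_def dy_def)

lemma has_derivative_dx_dy:
  assumes "f differentiable (at z)"
  shows "(f has_derivative (\<lambda>v. Re v *\<^sub>R dx f z + Im v *\<^sub>R dy f z)) (at z)"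
proof -
  let ?F = "frechet_derivative f (at z)"
  have F: "(f has_derivative ?F) (at z)"
    using assms frechet_derivative_works by blast
  then have lin: "linear ?F"
    by (rule has_derivative_linear)
  have "?F v = Re v *\<^sub>R dx f z + Im v *\<^sub>R dy f z" for v
  proof -
    have "v = Re v *\<^sub>R 1 + Im v *\<^sub>R \<i>"
      by (simp add: complex_eq_iff)
    then have "?F v = ?F (Re v *\<^sub>R 1 + Im v *\<^sub>R \<i>)"
      by simp
    also have "\<dots> = Re v *\<^sub>R dx f z + Im v *\<^sub>R dy f z"
      by (simp add: linear_add[OF lin] linear_scale[OF lin] dx_def dy_def)
    finally show ?thesis .
  qed
  then have "?F = (\<lambda>v. Re v *\<^sub>R dx f z + Im v *\<^sub>R dy f z)"
    by (rule ext)
  with F show ?thesis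
    by simp
qed

lemma dx_dy_cong_open:
  assumes "open U" "z \<in> U" "\<And>w. w \<in> U \<Longrightarrow> f w = g w"
  shows "dx f z = dx g z" "dy f z = dy g z"
proof -
  have "(f has_derivative F) (at z) \<longleftrightarrow> (g has_derivative F) (at z)" for F
    using has_derivative_transform_within_open[OF _ assms(1,2)] assms(3) by metis
  then show "dx f z = dx g z" "dy f z = dy g z"
    by (simp_all add: dx_def dy_def frechet_derivative_def)
qed

lemma Ck_on_cong_open:
  assumes "open U" "\<And>w. w \<in> U \<Longrightarrow> f w = g w" "Ck_on k f U"
  shows "Ck_on k g U"
  using assms(2,3)
proof (induction k arbitrary: f g)
  case 0
  then show ?case
    by (simp cong: continuous_on_cong)
next
  case (Suc k)
  have "g differentiable (at z)" if "z \<in> U" for z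
    using Suc.prems that has_derivative_transform_within_open[OF _ assms(1) that]
    unfolding differentiable_def by (metis Ck_on.simps(2) differentiable_def)
  moreover have "Ck_on k (dx g) U" "Ck_on k (dy g) U"
    using Suc.prems by (auto intro!: Suc.IH[of "dx f" "dx g"] Suc.IH[of "dy f" "dy g"]
        dx_dy_cong_open[OF assms(1)])
  ultimately show ?case
    by simp
qed

lemma Ck_on_Suc_imp: "Ck_on (Suc k) f U \<Longrightarrow> Ck_on k f U"
proof (induction k arbitrary: f)
  case 0
  then show ?case
    by (auto intro!: continuous_at_imp_continuous_on differentiable_imp_continuous_within)
next
  case (Suc k)
  then show ?case
    by (metis Ck_on.simps(2))
qed

lemma Ck_on_mono: "Ck_on k f U \<Longrightarrow> j \<le> k \<Longrightarrow> Ck_on j f U"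
proof (induction k)
  case (Suc k)
  then show ?case
    using Ck_on_Suc_imp le_Suc_eq by blast
qed simp

lemma Ck_on_subset: "Ck_on k f U \<Longrightarrow> V \<subseteq> U \<Longrightarrow> Ck_on k f V"
  by (induction k arbitrary: f) (auto intro: continuous_on_subset)

text \<open>The partial derivatives are read off any explicit derivative \<open>F\<close>, so that
  the closure properties of the classes follow by induction from the usual differentiation
  rules.\<close>

lemma Ck_on_SucI:
  assumes "open U"
    and "\<And>z. z \<in> U \<Longrightarrow> (f has_derivative F z) (at z)"
    and "Ck_on k (\<lambda>z. F z 1) U" "Ck_on k (\<lambda>z. F z \<i>) U"
  shows "Ck_on (Suc k) f U"
  using assms(2) dx_dy_eq[OF assms(2)]
    Ck_on_cong_open[OF assms(1) _ assms(3), of "dx f"]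
    Ck_on_cong_open[OF assms(1) _ assms(4), of "dy f"]
  by (auto simp: differentiable_def)

lemma dx_dy_const: "dx (\<lambda>z. c) = (\<lambda>z. 0)" "dy (\<lambda>z. c) = (\<lambda>z. 0)"
  by (intro ext, simp add: dx_dy_eq[OF has_derivative_const])+

lemma Ck_on_const: "Ck_on k (\<lambda>z. c) U"
  by (induction k arbitrary: c) (simp_all add: dx_dy_const)

lemma Ck_on_add:
  assumes "open U" "Ck_on k f U" "Ck_on k g U"
  shows "Ck_on k (\<lambda>z. f z + g z) U"
  using assms(2,3)
proof (induction k arbitrary: f g)
  case (Suc k)
  have "((\<lambda>z. f z + g z) has_derivative (\<lambda>v. (Re v *\<^sub>R dx f z + Im v *\<^sub>R dy f z)
          + (Re v *\<^sub>R dx g z + Im v *\<^sub>R dy g z))) (at z)" if "z \<in> U" for z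
    using Suc.prems that by (intro has_derivative_add has_derivative_dx_dy) auto
  then show ?case
    using Suc by (intro Ck_on_SucI[OF assms(1)]) auto
qed (auto intro: continuous_on_add)

lemma Ck_on_bounded_linear:
  assumes "bounded_linear L" "open U" "Ck_on k f U"
  shows "Ck_on k (\<lambda>z. L (f z)) U"
  using assms(3)
proof (induction k arbitrary: f)
  case 0
  then show ?case
    using bounded_linear.continuous_on[OF assms(1)] by auto
next
  case (Suc k)
  have "((\<lambda>z. L (f z)) has_derivative (\<lambda>v. L (Re v *\<^sub>R dx f z + Im v *\<^sub>R dy f z))) (at z)"
    if "z \<in> U" for z
    using Suc.prems that
    by (intro bounded_linear.has_derivative[OF assms(1)] has_derivative_dx_dy) auto
  then show ?case
    using Suc by (intro Ck_on_SucI[OF assms(2)]) auto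
qed

lemma Ck_on_diff:
  assumes "open U" "Ck_on k f U" "Ck_on k g U"
  shows "Ck_on k (\<lambda>z. f z - g z) U"
  using Ck_on_add[OF assms(1,2) Ck_on_bounded_linear[OF bounded_linear_minus[OF bounded_linear_ident] assms(1,3)]]
  by simp

lemma Ck_on_mult:
  fixes f g :: "complex \<Rightarrow> 'a::real_normed_algebra"
  assumes "open U" "Ck_on k f U" "Ck_on k g U"
  shows "Ck_on k (\<lambda>z. f z * g z) U"
  using assms(2,3)
proof (induction k arbitrary: f g)
  case (Suc k)
  have der: "((\<lambda>z. f z * g z) has_derivative (\<lambda>v. f z * (Re v *\<^sub>R dx g z + Im v *\<^sub>R dy g z)
          + (Re v *\<^sub>R dx f z + Im v *\<^sub>R dy f z) * g z)) (at z)" if "z \<in> U" for z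
    using Suc.prems that by (intro has_derivative_mult has_derivative_dx_dy) auto
  then show ?case
    using Suc Ck_on_Suc_imp[OF Suc.prems(1)] Ck_on_Suc_imp[OF Suc.prems(2)]
    by (intro Ck_on_SucI[OF assms(1) der]) (auto intro!: Ck_on_add[OF assms(1)])
qed (auto intro: continuous_on_mult)

lemma Ck_on_inverse:
  fixes f :: "complex \<Rightarrow> real"
  assumes "open U" "\<And>z. z \<in> U \<Longrightarrow> f z \<noteq> 0" "Ck_on k f U"
  shows "Ck_on k (\<lambda>z. inverse (f z)) U"
  using assms(3)
proof (induction k)
  case (Suc k)
  have der: "((\<lambda>z. inverse (f z)) has_derivative
      (\<lambda>v. - (inverse (f z) * (Re v *\<^sub>R dx f z + Im v *\<^sub>R dy f z) * inverse (f z)))) (at z)"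
    if "z \<in> U" for z
    using Suc.prems that assms(2) by (intro Deriv.has_derivative_inverse has_derivative_dx_dy) auto
  have IH: "Ck_on k (\<lambda>z. inverse (f z)) U"
    using Suc Ck_on_Suc_imp by blast
  have "Ck_on k (\<lambda>z. - (inverse (f z) * D f z * inverse (f z))) U" if "Ck_on k (D f) U" for D
    by (intro Ck_on_bounded_linear[OF bounded_linear_minus[OF bounded_linear_ident]]
        Ck_on_mult assms(1) IH that)
  then show ?case
    using Suc.prems by (intro Ck_on_SucI[OF assms(1) der]) auto
qed (auto intro!: continuous_intros simp: assms(2))

lemma Ck_on_ln:
  fixes f :: "complex \<Rightarrow> real"
  assumes "open U" "\<And>z. z \<in> U \<Longrightarrow> f z > 0" "Ck_on k f U"
  shows "Ck_on k (\<lambda>z. ln (f z)) U"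
proof (cases k)
  case 0
  then show ?thesis
    using assms by (force intro!: continuous_intros)
next
  case (Suc m)
  have der: "((\<lambda>z. ln (f z)) has_derivative
      (\<lambda>v. (Re v *\<^sub>R dx f z + Im v *\<^sub>R dy f z) * inverse (f z))) (at z)" if "z \<in> U" for z
    using assms(2)[OF that] assms(3) Suc that
    by (auto intro!: derivative_eq_intros has_derivative_dx_dy simp: divide_simps)
  have "Ck_on m (\<lambda>z. inverse (f z)) U"
    using assms Suc Ck_on_Suc_imp by (intro Ck_on_inverse) force+
  then show ?thesis
    using assms(3) unfolding Suc
    by (intro Ck_on_SucI[OF assms(1) der]) (auto intro!: Ck_on_mult[OF assms(1)])
qed

lemma Ck_on_holomorphic:
  assumes "open U" "f holomorphic_on U"
  shows "Ck_on k f U"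
  using assms(2)
proof (induction k arbitrary: f)
  case 0
  then show ?case
    by (auto intro: holomorphic_on_imp_continuous_on)
next
  case (Suc k)
  have der: "(f has_derivative (\<lambda>v. deriv f z * v)) (at z)" if "z \<in> U" for z
    using holomorphic_derivI[OF Suc.prems assms(1) that] by (simp add: has_field_derivative_def)
  moreover have "Ck_on k (deriv f) U"
    using Suc by (blast intro: holomorphic_deriv assms(1))
  moreover from this have "Ck_on k (\<lambda>z. deriv f z * \<i>) U"
    by (intro Ck_on_mult Ck_on_const assms(1))
  ultimately show ?case
    by (intro Ck_on_SucI[OF assms(1) der]) auto
qed

text \<open>Real counterpart of \<open>laplacian\<close>, which is built from Wirtinger derivatives
  of complex functions; \<open>laplacian_of_real\<close> identifies the two by the symmetry of mixed
  derivatives.\<close>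

definition lap :: "(complex \<Rightarrow> real) \<Rightarrow> complex \<Rightarrow> real" where
  "lap f z = dx (dx f) z + dy (dy f) z"

section \<open>Linearity of first and second derivatives\<close>

lemma dx_dy_diff:
  assumes "f differentiable (at z)" "g differentiable (at z)"
  shows "dx (\<lambda>w. f w - g w) z = dx f z - dx g z" "dy (\<lambda>w. f w - g w) z = dy f z - dy g z"
  using dx_dy_eq[OF has_derivative_diff[OF assms[THEN has_derivative_dx_dy]]] by auto

lemma dx_dy_cmult:
  fixes f :: "complex \<Rightarrow> real"
  assumes "f differentiable (at z)"
  shows "dx (\<lambda>w. c * f w) z = c * dx f z" "dy (\<lambda>w. c * f w) z = c * dy f z"
  using dx_dy_eq[OF has_derivative_mult_right[OF assms[THEN has_derivative_dx_dy]]] by auto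

lemma second_diff:
  assumes "open U" "z \<in> U" "Ck_on 2 f U" "Ck_on 2 g U"
  shows "dx (dx (\<lambda>w. f w - g w)) z = dx (dx f) z - dx (dx g) z"
    and "dx (dy (\<lambda>w. f w - g w)) z = dx (dy f) z - dx (dy g) z"
    and "dy (dx (\<lambda>w. f w - g w)) z = dy (dx f) z - dy (dx g) z"
    and "dy (dy (\<lambda>w. f w - g w)) z = dy (dy f) z - dy (dy g) z"
proof -
  have diff: "h differentiable (at w)" "dx h differentiable (at w)" "dy h differentiable (at w)"
    if "Ck_on 2 h U" "w \<in> U" for h :: "complex \<Rightarrow> 'a" and w
    using that by (auto simp: numeral_2_eq_2)
  note * = diff[OF assms(3)] diff[OF assms(4)]
  have "dx (\<lambda>w. f w - g w) w = dx f w - dx g w" "dy (\<lambda>w. f w - g w) w = dy f w - dy g w"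
    if "w \<in> U" for w
    by (simp_all add: dx_dy_diff * that)
  note cong = dx_dy_cong_open[OF assms(1,2) this(1)] dx_dy_cong_open[OF assms(1,2) this(2)]
  show "dx (dx (\<lambda>w. f w - g w)) z = dx (dx f) z - dx (dx g) z"
    "dx (dy (\<lambda>w. f w - g w)) z = dx (dy f) z - dx (dy g) z"
    "dy (dx (\<lambda>w. f w - g w)) z = dy (dx f) z - dy (dx g) z"
    "dy (dy (\<lambda>w. f w - g w)) z = dy (dy f) z - dy (dy g) z"
    by (simp_all add: cong * dx_dy_diff assms(2))
qed

lemma second_cmult:
  fixes f :: "complex \<Rightarrow> real"
  assumes "open U" "z \<in> U" "Ck_on 2 f U"
  shows "dx (dx (\<lambda>w. c * f w)) z = c * dx (dx f) z"
    and "dx (dy (\<lambda>w. c * f w)) z = c * dx (dy f) z"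
    and "dy (dx (\<lambda>w. c * f w)) z = c * dy (dx f) z"
    and "dy (dy (\<lambda>w. c * f w)) z = c * dy (dy f) z"
proof -
  have diff: "f differentiable (at w)" "dx f differentiable (at w)" "dy f differentiable (at w)"
    if "w \<in> U" for w
    using that assms(3) by (auto simp: numeral_2_eq_2)
  have "dx (\<lambda>w. c * f w) w = c * dx f w" "dy (\<lambda>w. c * f w) w = c * dy f w"
    if "w \<in> U" for w
    by (simp_all add: dx_dy_cmult diff that)
  note cong = dx_dy_cong_open[OF assms(1,2) this(1)] dx_dy_cong_open[OF assms(1,2) this(2)]
  show "dx (dx (\<lambda>w. c * f w)) z = c * dx (dx f) z"
    "dx (dy (\<lambda>w. c * f w)) z = c * dx (dy f) z"
    "dy (dx (\<lambda>w. c * f w)) z = c * dy (dx f) z"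
    "dy (dy (\<lambda>w. c * f w)) z = c * dy (dy f) z"
    by (simp_all add: cong diff dx_dy_cmult assms(2))
qed

lemma lap_diff:
  assumes "open U" "z \<in> U" "Ck_on 2 f U" "Ck_on 2 g U"
  shows "lap (\<lambda>w. f w - g w) z = lap f z - lap g z"
  by (simp add: lap_def second_diff[OF assms])

section \<open>Interior gradient estimate for the Poisson equation\<close>

text \<open>If \<open>c\<close> were positive, \<open>f'\<close>, which vanishes at the maximum,
  would be positive just to the right of it, and by the mean value theorem \<open>f\<close> would
  exceed \<open>f t\<close> there.\<close>

lemma second_derivative_nonpos_at_max:
  fixes f :: "real \<Rightarrow> real"
  assumes "d > 0"
    and f': "\<And>s. \<bar>s - t\<bar> < d \<Longrightarrow> (f has_field_derivative f' s) (at s)"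
    and f'': "(f' has_field_derivative c) (at t)"
    and max: "\<And>s. \<bar>s - t\<bar> < d \<Longrightarrow> f s \<le> f t"
  shows "c \<le> 0"
proof (rule ccontr)
  assume "\<not> c \<le> 0"
  have "f' t = 0"
    using DERIV_local_max[OF f' \<open>d > 0\<close>] max assms(1) by (simp add: abs_minus_commute)
  obtain e where "e > 0" and inc: "\<And>s. s > 0 \<Longrightarrow> s < e \<Longrightarrow> f' t < f' (t + s)"
    using DERIV_pos_inc_right[OF f''] \<open>\<not> c \<le> 0\<close> by force
  define s where "s = min d e / 2"
  have s: "0 < s" "s < d" "s < e"
    using \<open>d > 0\<close> \<open>e > 0\<close> by (auto simp: s_def)
  obtain x where x: "t < x" "x < t + s" "f (t + s) - f t = (t + s - t) * f' x"
    using MVT2[of t "t + s" f f'] f' s by auto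
  have "f' x > 0"
    using inc[of "x - t"] x s \<open>f' t = 0\<close> by auto
  then have "f (t + s) - f t > 0"
    using x(3) s by simp
  with max[of "t + s"] s show False
    by auto
qed

lemma has_field_derivative_Complex:
  fixes g :: "complex \<Rightarrow> real"
  assumes "g differentiable (at (z + Complex x y))"
  shows "((\<lambda>t. g (z + Complex t y)) has_field_derivative dx g (z + Complex x y)) (at x)"
    and "((\<lambda>t. g (z + Complex x t)) has_field_derivative dy g (z + Complex x y)) (at y)"
proof -
  note g = has_derivative_dx_dy[OF assms]
  have 1: "((\<lambda>t. z + Complex t y) has_derivative (\<lambda>h. of_real h)) (at x)"
    unfolding Complex_eq by (auto intro!: derivative_eq_intros)
  have 2: "((\<lambda>t. z + Complex x t) has_derivative (\<lambda>h. \<i> * of_real h)) (at y)"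
    unfolding Complex_eq by (auto intro!: derivative_eq_intros)
  show "((\<lambda>t. g (z + Complex t y)) has_field_derivative dx g (z + Complex x y)) (at x)"
    using has_derivative_compose[OF 1 g] by (simp add: has_field_derivative_def mult_commute_abs)
  show "((\<lambda>t. g (z + Complex x t)) has_field_derivative dy g (z + Complex x y)) (at y)"
    using has_derivative_compose[OF 2 g] by (simp add: has_field_derivative_def mult_commute_abs)
qed

text \<open>The mean value theorem is applied twice to the alternating sum over the corners of a
  square, once in each order of the two variables.\<close>

lemma second_difference_eq:
  assumes d: "ball z d \<subseteq> U" and C2: "Ck_on 2 f U" and h: "0 < h" "2 * h < d"
  defines "S \<equiv> f (z + Complex h h) - f (z + Complex h 0) - f (z + Complex 0 h) + f (z :: complex) :: real"
  shows "\<exists>p. dist p z < d \<and> S = h * h * dy (dx f) p"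
    and "\<exists>p. dist p z < d \<and> S = h * h * dx (dy f) p"
proof -
  have near: "dist (z + Complex s t) z < d" if "0 \<le> s" "s \<le> h" "0 \<le> t" "t \<le> h" for s t
    using that h norm_triangle_ineq[of "of_real s" "\<i> * of_real t"]
    by (auto simp: dist_norm Complex_eq norm_mult)
  then have U: "z + Complex s t \<in> U" if "0 \<le> s" "s \<le> h" "0 \<le> t" "t \<le> h" for s t
    using that d by (auto simp: dist_commute subset_iff)
  have diff: "f differentiable (at w)" "dx f differentiable (at w)" "dy f differentiable (at w)"
    if "w \<in> U" for w
    using that C2 by (auto simp: numeral_2_eq_2)
  have z: "Complex 0 0 = 0"
    by (simp add: complex_eq_iff)
  have "\<exists>s. 0 < s \<and> s < h \<and> (f (z + Complex h h) - f (z + Complex h 0))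
      - (f (z + Complex 0 h) - f (z + Complex 0 0))
      = (h - 0) * (dx f (z + Complex s h) - dx f (z + Complex s 0))"
    by (rule MVT2[where f = "\<lambda>s. f (z + Complex s h) - f (z + Complex s 0)", OF h(1)])
       (use h in \<open>auto intro!: derivative_intros has_field_derivative_Complex diff U\<close>)
  then obtain s where s: "0 < s" "s < h" "S = h * (dx f (z + Complex s h) - dx f (z + Complex s 0))"
    by (auto simp: S_def z algebra_simps)
  have "\<exists>t. 0 < t \<and> t < h \<and> dx f (z + Complex s h) - dx f (z + Complex s 0)
      = (h - 0) * dy (dx f) (z + Complex s t)"
    by (rule MVT2[where f = "\<lambda>t. dx f (z + Complex s t)", OF h(1)])
       (use s in \<open>auto intro!: has_field_derivative_Complex diff U\<close>)
  then show "\<exists>p. dist p z < d \<and> S = h * h * dy (dx f) p"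
    using s near by (metis diff_zero less_eq_real_def mult.assoc)
  have "\<exists>t. 0 < t \<and> t < h \<and> (f (z + Complex h h) - f (z + Complex 0 h))
      - (f (z + Complex h 0) - f (z + Complex 0 0))
      = (h - 0) * (dy f (z + Complex h t) - dy f (z + Complex 0 t))"
    by (rule MVT2[where f = "\<lambda>t. f (z + Complex h t) - f (z + Complex 0 t)", OF h(1)])
       (use h in \<open>auto intro!: derivative_intros has_field_derivative_Complex diff U\<close>)
  then obtain t where t: "0 < t" "t < h" "S = h * (dy f (z + Complex h t) - dy f (z + Complex 0 t))"
    by (auto simp: S_def z algebra_simps)
  have "\<exists>s. 0 < s \<and> s < h \<and> dy f (z + Complex h t) - dy f (z + Complex 0 t)
      = (h - 0) * dx (dy f) (z + Complex s t)"
    by (rule MVT2[where f = "\<lambda>s. dy f (z + Complex s t)", OF h(1)])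
       (use t in \<open>auto intro!: has_field_derivative_Complex diff U\<close>)
  then show "\<exists>p. dist p z < d \<and> S = h * h * dx (dy f) p"
    using t near by (metis diff_zero less_eq_real_def mult.assoc)
qed

text \<open>By continuity, unequal mixed derivatives at \<open>z\<close> would keep disjoint ranges
  near \<open>z\<close>, while the second difference of a small square is a value of both, up to the
  same factor.\<close>

lemma dx_dy_commute:
  fixes f :: "complex \<Rightarrow> real"
  assumes "open U" "z \<in> U" "Ck_on 2 f U"
  shows "dx (dy f) z = dy (dx f) z"
proof (rule ccontr)
  \<comment> \<open>Half the gap: the open intervals of radius \<open>e\<close> about the two values
    are disjoint.\<close>
  define e where "e = \<bar>dx (dy f) z - dy (dx f) z\<bar> / 2"
  assume "dx (dy f) z \<noteq> dy (dx f) z"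
  then have "e > 0"
    by (simp add: e_def)
  have "isCont (dx (dy f)) z" "isCont (dy (dx f)) z"
    using assms by (auto simp: numeral_2_eq_2 continuous_on_eq_continuous_at)
  then obtain d1 d2 where d12: "d1 > 0" "\<And>p. dist p z < d1 \<Longrightarrow> \<bar>dx (dy f) p - dx (dy f) z\<bar> < e"
      "d2 > 0" "\<And>p. dist p z < d2 \<Longrightarrow> \<bar>dy (dx f) p - dy (dx f) z\<bar> < e"
    unfolding continuous_at_eps_delta dist_real_def using \<open>e > 0\<close> by metis
  obtain d3 where "d3 > 0" "ball z d3 \<subseteq> U"
    using assms(1,2) openE by blast
  define d where "d = min d3 (min d1 d2)"
  have "d > 0" "ball z d \<subseteq> U"
    using d12 \<open>d3 > 0\<close> \<open>ball z d3 \<subseteq> U\<close> by (auto simp: d_def)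
  note S = second_difference_eq[OF this(2) assms(3), of "d / 3"]
  obtain p q where "dist p z < d" "dist q z < d" "dy (dx f) p = dx (dy f) q"
    using S \<open>d > 0\<close> by force
  then show False
    using d12(2)[of q] d12(4)[of p] by (simp add: e_def d_def abs_if split: if_splits)
qed

text \<open>Makes the first derivatives of a solution solve a Poisson equation too, with the
  differentiated right-hand side; the gradient estimate can then be applied to them.\<close>

lemma lap_dx_dy_commute:
  assumes "Ck_on 3 f UNIV"
  shows "lap (dx f) z = dx (lap f) z" "lap (dy f) z = dy (lap f) z"
proof -
  have C2: "Ck_on 2 f UNIV" "Ck_on 2 (dx f) UNIV" "Ck_on 2 (dy f) UNIV"
    using assms Ck_on_mono[OF assms, of 2] by (auto simp: numeral_3_eq_3 numeral_2_eq_2)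
  then have diff: "dx (dx f) differentiable (at z)" "dy (dy f) differentiable (at z)" 
    by (auto simp: numeral_2_eq_2)
  have eq: "dx (dy f) = dy (dx f)"
    using dx_dy_commute[OF open_UNIV UNIV_I C2(1)] by blast
  have lap: "dx (lap f) z = dx (dx (dx f)) z + dx (dy (dy f)) z"
    "dy (lap f) z = dy (dx (dx f)) z + dy (dy (dy f)) z"
    using dx_dy_eq[OF has_derivative_add[OF diff[THEN has_derivative_dx_dy]]]
    by (simp_all add: lap_def[abs_def])
  show "lap (dx f) z = dx (lap f) z" "lap (dy f) z = dy (lap f) z"
    using dx_dy_commute[OF open_UNIV UNIV_I C2(2), of z] dx_dy_commute[OF open_UNIV UNIV_I C2(3), of z]
    unfolding lap lap_def eq by simp_all
qed

text \<open>The one-variable test along the horizontal and the vertical line through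
  \<open>z\<close> makes each pure second derivative nonpositive.\<close>

lemma lap_nonpos_at_max:
  assumes "open U" "z \<in> U" and C2: "Ck_on 2 g U" and max: "\<And>y. y \<in> U \<Longrightarrow> g y \<le> g z"
  shows "lap g z \<le> 0"
proof -
  obtain d where "d > 0" and d: "ball z d \<subseteq> U"
    using assms(1,2) openE by blast
  have U: "z + Complex s 0 \<in> U" "z + Complex 0 s \<in> U" if "\<bar>s - 0\<bar> < d" for s
    using that d by (auto simp: subset_iff dist_norm complex_norm)
  have diff: "g differentiable (at w)" "dx g differentiable (at w)" "dy g differentiable (at w)"
    if "w \<in> U" for w
    using that C2 by (auto simp: numeral_2_eq_2)
  have "dx (dx g) z \<le> 0"
  proof (rule second_derivative_nonpos_at_max[OF \<open>d > 0\<close>, where t = 0])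
    show "((\<lambda>t. dx g (z + Complex t 0)) has_field_derivative dx (dx g) z) (at 0)"
      using has_field_derivative_Complex(1)[of "dx g" z 0 0] diff(2) assms(2)
      by (simp add: Complex_eq)
    show "((\<lambda>t. g (z + Complex t 0)) has_field_derivative dx g (z + Complex s 0)) (at s)"
      if "\<bar>s - 0\<bar> < d" for s
      by (intro has_field_derivative_Complex diff U that)
  qed (use U max in \<open>auto simp: Complex_eq\<close>)
  moreover have "dy (dy g) z \<le> 0"
  proof (rule second_derivative_nonpos_at_max[OF \<open>d > 0\<close>, where t = 0])
    show "((\<lambda>t. dy g (z + Complex 0 t)) has_field_derivative dy (dy g) z) (at 0)"
      using has_field_derivative_Complex(2)[of "dy g" z 0 0] diff(3) assms(2)
      by (simp add: Complex_eq)
    show "((\<lambda>t. g (z + Complex 0 t)) has_field_derivative dy g (z + Complex 0 s)) (at s)"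
      if "\<bar>s - 0\<bar> < d" for s
      by (intro has_field_derivative_Complex diff U that)
  qed (use U max in \<open>auto simp: Complex_eq\<close>)
  ultimately show ?thesis
    by (simp add: lap_def)
qed

text \<open>Following Gilbarg and Trudinger (section 3.4), the odd part of \<open>G\<close> in \<open>x\<close> is compared
  on \<open>[0, 1] \<times> [-1, 1]\<close> with the barrier \<open>M (y\<^sup>2 + x (2 - x)) + N x (1 - x) / 2\<close>, whose
  Laplacian is \<open>-N\<close>.\<close>

lemma partial_derivative_le:
  fixes G Gx Gxx Gy Gyy :: "real \<Rightarrow> real \<Rightarrow> real"
  defines "Q \<equiv> {-1..1}"
  assumes cont: "continuous_on UNIV (\<lambda>p. G (fst p) (snd p))"
    and x: "\<And>x y. x \<in> Q \<Longrightarrow> y \<in> Q \<Longrightarrow> ((\<lambda>t. G t y) has_field_derivative Gx x y) (at x)"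
    and xx: "\<And>x y. x \<in> Q \<Longrightarrow> y \<in> Q \<Longrightarrow> ((\<lambda>t. Gx t y) has_field_derivative Gxx x y) (at x)"
    and y: "\<And>x y. x \<in> Q \<Longrightarrow> y \<in> Q \<Longrightarrow> (G x has_field_derivative Gy x y) (at y)"
    and yy: "\<And>x y. x \<in> Q \<Longrightarrow> y \<in> Q \<Longrightarrow> (Gy x has_field_derivative Gyy x y) (at y)"
    and M: "\<And>x y. x \<in> Q \<Longrightarrow> y \<in> Q \<Longrightarrow> \<bar>G x y\<bar> \<le> M"
    and N: "\<And>x y. x \<in> Q \<Longrightarrow> y \<in> Q \<Longrightarrow> \<bar>Gxx x y + Gyy x y\<bar> < N"
  shows "Gx 0 0 \<le> 2 * M + N / 2"
proof -
  define F where "F x y = (G x y - G (- x) y) / 2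
      - (M * (y\<^sup>2 + x * (2 - x)) + N / 2 * (x * (1 - x)))" for x y
  define Fx where "Fx x y = (Gx x y + Gx (- x) y) / 2 - (M * (2 - 2 * x) + N / 2 * (1 - 2 * x))" for x y
  define Fxx where "Fxx x y = (Gxx x y - Gxx (- x) y) / 2 + 2 * M + N" for x y
  define Fy where "Fy x y = (Gy x y - Gy (- x) y) / 2 - M * (2 * y)" for x y
  define Fyy where "Fyy x y = (Gyy x y - Gyy (- x) y) / 2 - M * 2" for x y
  have neg: "- x \<in> Q \<longleftrightarrow> x \<in> Q" for x
    by (auto simp: Q_def)
  have refl: "((\<lambda>t. H (- t) y) has_field_derivative - D) (at x)"
    if "((\<lambda>t. H t y) has_field_derivative D) (at (- x))" for H :: "real \<Rightarrow> real \<Rightarrow> real" and D x y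
    using DERIV_chain2[where f = "\<lambda>t. H t y" and g = uminus, OF that, of "-1"]
    by (simp add: DERIV_minus[OF DERIV_ident])
  have Gneg: "((\<lambda>t. G (- t) y) has_field_derivative - Gx (- x) y) (at x)"
    "((\<lambda>t. Gx (- t) y) has_field_derivative - Gxx (- x) y) (at x)" if "x \<in> Q" "y \<in> Q" for x y
    by (intro refl x xx; simp add: neg that)+
  have Fx: "((\<lambda>t. F t y) has_field_derivative Fx x y) (at x)" if "x \<in> Q" "y \<in> Q" for x y
    unfolding F_def Fx_def using that
    by (auto intro!: derivative_eq_intros x Gneg simp: field_simps)
  have Fxx: "((\<lambda>t. Fx t y) has_field_derivative Fxx x y) (at x)" if "x \<in> Q" "y \<in> Q" for x y
    unfolding Fx_def Fxx_def using that
    by (auto intro!: derivative_eq_intros xx Gneg simp: field_simps)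
  have Fy: "(F x has_field_derivative Fy x y) (at y)" if "x \<in> Q" "y \<in> Q" for x y
    unfolding F_def Fy_def using that
    by (auto intro!: derivative_eq_intros y simp: neg)
  have Fyy: "(Fy x has_field_derivative Fyy x y) (at y)" if "x \<in> Q" "y \<in> Q" for x y
    unfolding Fy_def Fyy_def using that
    by (auto intro!: derivative_eq_intros yy simp: neg)
  have "M \<ge> 0" "N > 0"
    using M[of 0 0] N[of 0 0] by (auto simp: Q_def)
  have F_le: "F x y \<le> 0" if "x \<in> {0..1}" "y \<in> Q" for x y
  proof -
    have "continuous_on UNIV (\<lambda>p. G (- fst p) (snd p))"
      using continuous_on_compose2[OF cont, of UNIV "\<lambda>p. (- fst p, snd p)"]
      by (simp add: continuous_intros)
    then have "continuous_on ({0..1} \<times> Q) (\<lambda>p. F (fst p) (snd p))"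
      unfolding F_def by (auto intro!: continuous_intros continuous_on_subset[OF cont]
          intro: continuous_on_subset)
    moreover have "compact ({0..1::real} \<times> Q)" "{0..1::real} \<times> Q \<noteq> {}"
      by (auto intro!: compact_Times simp: Q_def)
    ultimately obtain a b where ab: "a \<in> {0..1}" "b \<in> Q"
      and max: "\<And>x y. x \<in> {0..1} \<Longrightarrow> y \<in> Q \<Longrightarrow> F x y \<le> F a b"
      using continuous_attains_sup[of "{0..1} \<times> Q" "\<lambda>p. F (fst p) (snd p)"] by fastforce
    have "F a b \<le> 0"
    proof (cases "a = 0 \<or> a = 1 \<or> b = 1 \<or> b = -1")
      \<comment> \<open>On the edge a = 0 the odd part vanishes. On the other three edges b^2 + a (2
        - a) is at least 1, so the barrier dominates \<open>M\<close>.\<close>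
      case True
      have "\<bar>G a b\<bar> \<le> M" "\<bar>G (- a) b\<bar> \<le> M"
        using M[of a b] M[of "- a" b] ab by (auto simp: Q_def)
      then have "(G a b - G (- a) b) / 2 \<le> M"
        by simp
      moreover have "M * (b\<^sup>2 + a * (2 - a)) \<ge> M" if "a \<noteq> 0"
      proof -
        have "b\<^sup>2 + a * (2 - a) \<ge> 1"
          using True that ab by auto
        then show ?thesis
          using \<open>M \<ge> 0\<close> by (simp add: mult_le_cancel_left1)
      qed
      moreover have "M * b\<^sup>2 \<ge> 0" "N / 2 * (a * (1 - a)) \<ge> 0"
        using ab \<open>M \<ge> 0\<close> \<open>N > 0\<close> by auto
      ultimately show ?thesis
        unfolding F_def by (cases "a = 0") auto
    next
      case False
      define d where "d = min (min a (1 - a)) (min (1 - b) (1 + b))"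
      have "d > 0"
        using False ab by (auto simp: d_def Q_def)
      have near: "\<bar>s - a\<bar> < d \<Longrightarrow> s \<in> {0..1} \<and> s \<in> Q" "\<bar>s - b\<bar> < d \<Longrightarrow> s \<in> Q" for s
        by (auto simp: d_def Q_def)
      have "a \<in> Q"
        using ab by (auto simp: Q_def)
      \<comment> \<open>An interior maximum is contradictory: \<open>Fxx + Fyy\<close> would be
        nonpositive there, but subtracting the barrier contributes \<open>N\<close> and the odd part
        of the Laplacian contributes more than \<open>-N\<close>.\<close>
      have "Fxx a b \<le> 0"
        by (rule second_derivative_nonpos_at_max[OF \<open>d > 0\<close> Fx Fxx])
           (use near \<open>a \<in> Q\<close> ab max in auto)
      moreover have "Fyy a b \<le> 0"
        by (rule second_derivative_nonpos_at_max[OF \<open>d > 0\<close> Fy Fyy])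
           (use near \<open>a \<in> Q\<close> ab max in auto)
      ultimately show ?thesis
        using N[OF \<open>a \<in> Q\<close> ab(2)] N[of "- a" b] \<open>a \<in> Q\<close> ab(2)
        unfolding Fxx_def Fyy_def neg abs_less_iff by (simp add: field_simps)
    qed
    then show ?thesis
      using max[OF that] by simp
  qed
  have "((\<lambda>t. F t 0) has_field_derivative Fx 0 0) (at 0)"
    by (rule Fx) (auto simp: Q_def)
  then have "Fx 0 0 \<le> 0"
  proof (rule contrapos_pp)
    assume "\<not> Fx 0 0 \<le> 0"
    show "\<not> ((\<lambda>t. F t 0) has_field_derivative Fx 0 0) (at 0)"
    proof
      assume "((\<lambda>t. F t 0) has_field_derivative Fx 0 0) (at 0)"
      from DERIV_pos_inc_right[OF this] obtain e where "e > 0"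
        and inc: "\<And>s. s > 0 \<Longrightarrow> s < e \<Longrightarrow> F 0 0 < F s 0"
        using \<open>\<not> Fx 0 0 \<le> 0\<close> by force
      have "F (min (e / 2) 1) 0 > F 0 0"
        using inc \<open>e > 0\<close> by auto
      moreover have "F (min (e / 2) 1) 0 \<le> 0"
        using \<open>e > 0\<close> by (intro F_le) (auto simp: Q_def)
      moreover have "F 0 0 = 0"
        by (simp add: F_def)
      ultimately show False
        by simp
    qed
  qed
  \<comment> \<open>\<open>Fx 0 0\<close> is \<open>Gx 0 0\<close> minus the slope of the barrier at
    the origin, and this slope is the bound claimed.\<close>
  then show ?thesis
    by (simp add: Fx_def)
qed

text \<open>The square of side 2 centred at \<open>z\<close> lies in the disc of radius 2. The bound
  for \<open>dy\<close> is the one for \<open>dx\<close> with the coordinates exchanged.\<close>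

lemma dx_dy_le:
  assumes C2: "Ck_on 2 g UNIV"
    and M: "\<And>w. w \<in> cball z 2 \<Longrightarrow> \<bar>g w\<bar> \<le> M"
    and N: "\<And>w. w \<in> cball z 2 \<Longrightarrow> \<bar>lap g w\<bar> < N"
  shows "dx g z \<le> 2 * M + N / 2" "dy g z \<le> 2 * M + N / 2"
proof -
  have near: "z + Complex x y \<in> cball z 2" if "x \<in> {-1..1}" "y \<in> {-1..1}" for x y
    using that norm_triangle_ineq[of "- of_real x" "- (\<i> * of_real y)"]
    by (auto simp: dist_norm Complex_eq norm_mult)
  have diff: "g differentiable (at w)" "dx g differentiable (at w)" "dy g differentiable (at w)" for w
    using C2 by (auto simp: numeral_2_eq_2)
  have cont: "continuous_on A g" for A
    using diff(1) by (meson continuous_at_imp_continuous_on differentiable_imp_continuous_within)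
  have "continuous_on UNIV (\<lambda>p. g (z + Complex (fst p) (snd p)))"
    "continuous_on UNIV (\<lambda>p. g (z + Complex (snd p) (fst p)))"
    by (auto intro!: continuous_on_compose2[OF cont] continuous_intros simp: Complex_eq)
  note cont2 = this
  have "dx g (z + Complex 0 0) \<le> 2 * M + N / 2"
    by (rule partial_derivative_le[OF cont2(1)])
       (auto intro!: has_field_derivative_Complex diff M N[unfolded lap_def] near)
  then show "dx g z \<le> 2 * M + N / 2"
    by (simp add: Complex_eq)
  have "dy g (z + Complex 0 0) \<le> 2 * M + N / 2"
    by (rule partial_derivative_le[OF cont2(2), where Gx = "\<lambda>x y. dy g (z + Complex y x)"])
       (auto intro!: has_field_derivative_Complex diff M N[unfolded lap_def] near simp: add.commute[of "dy (dy g) _"])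
  then show "dy g z \<le> 2 * M + N / 2"
    by (simp add: Complex_eq)
qed

text \<open>The gradient estimate for \<open>f j - g\<close> and for \<open>g - f j\<close> bounds
  the partial derivatives from both sides. It looks at a neighbourhood of \<open>K\<close>, which is
  why convergence is assumed on all compact sets.\<close>

lemma uniform_limit_dx_dy:
  fixes f :: "nat \<Rightarrow> complex \<Rightarrow> real"
  assumes f: "\<And>j. Ck_on 2 (f j) UNIV" and g: "Ck_on 2 g UNIV"
    and lim: "\<And>K. compact K \<Longrightarrow> uniform_limit K f g sequentially"
    and lap: "\<And>K. compact K \<Longrightarrow> uniform_limit K (\<lambda>j. lap (f j)) (lap g) sequentially"
    and "compact K"
  shows "uniform_limit K (\<lambda>j. dx (f j)) (dx g) sequentially"
    and "uniform_limit K (\<lambda>j. dy (f j)) (dy g) sequentially"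
proof -
  define K' where "K' = {x + y |x y. x \<in> K \<and> y \<in> cball (0::complex) 2}"
  have "compact K'"
    unfolding K'_def using \<open>compact K\<close> by (intro compact_sums) auto
  have near: "w \<in> K'" if "z \<in> K" "w \<in> cball z 2" for z w
  proof -
    have "w = z + (w - z)" "w - z \<in> cball 0 2"
      using that by (auto simp: dist_norm norm_minus_commute)
    then show ?thesis
      using that unfolding K'_def by blast
  qed
  have diff: "h differentiable (at w)" if "Ck_on 2 h UNIV" for h :: "complex \<Rightarrow> real" and w
    using that by (auto simp: numeral_2_eq_2)
  have ev: "\<forall>\<^sub>F j in sequentially. \<forall>z\<in>K. \<bar>dx (f j) z - dx g z\<bar> < e \<and> \<bar>dy (f j) z - dy g z\<bar> < e"
    if "e > 0" for e
  proof -
    \<comment> \<open>With M = N = e / 4 the gradient bound 2 M + N / 2 equals 5 e / 8, which is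
      below \<open>e\<close>.\<close>
    have "\<forall>\<^sub>F j in sequentially. \<forall>z\<in>K'. dist (f j z) (g z) < e / 4"
      "\<forall>\<^sub>F j in sequentially. \<forall>z\<in>K'. dist (lap (f j) z) (lap g z) < e / 4"
      using uniform_limitD[OF lim[OF \<open>compact K'\<close>], of "e / 4"]
        uniform_limitD[OF lap[OF \<open>compact K'\<close>], of "e / 4"] that by auto
    then show ?thesis
    proof eventually_elim
      case (elim j)
      show ?case
      proof
        fix z assume "z \<in> K"
        have C2: "Ck_on 2 (\<lambda>w. f j w - g w) UNIV" "Ck_on 2 (\<lambda>w. g w - f j w) UNIV"
          using f g by (auto intro: Ck_on_diff)
        have M: "\<bar>f j w - g w\<bar> \<le> e / 4" "\<bar>g w - f j w\<bar> \<le> e / 4"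
          if "w \<in> cball z 2" for w
          using elim(1) near[OF \<open>z \<in> K\<close> that] by (force simp: dist_real_def abs_minus_commute)+
        have N: "\<bar>lap (\<lambda>w. f j w - g w) w\<bar> < e / 4" "\<bar>lap (\<lambda>w. g w - f j w) w\<bar> < e / 4"
          if "w \<in> cball z 2" for w
          using elim(2) near[OF \<open>z \<in> K\<close> that]
          by (force simp: dist_real_def abs_minus_commute lap_diff[OF open_UNIV _ f g]
              lap_diff[OF open_UNIV _ g f])+
        have "dx (\<lambda>w. f j w - g w) z \<le> 2 * (e / 4) + e / 4 / 2"
          "dy (\<lambda>w. f j w - g w) z \<le> 2 * (e / 4) + e / 4 / 2"
          "dx (\<lambda>w. g w - f j w) z \<le> 2 * (e / 4) + e / 4 / 2"
          "dy (\<lambda>w. g w - f j w) z \<le> 2 * (e / 4) + e / 4 / 2"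
          using dx_dy_le[OF C2(1) M(1) N(1)] dx_dy_le[OF C2(2) M(2) N(2)] by blast+
        then show "\<bar>dx (f j) z - dx g z\<bar> < e \<and> \<bar>dy (f j) z - dy g z\<bar> < e"
          using \<open>e > 0\<close> by (simp add: dx_dy_diff diff f g abs_if)
      qed
    qed
  qed
  show "uniform_limit K (\<lambda>j. dx (f j)) (dx g) sequentially"
    "uniform_limit K (\<lambda>j. dy (f j)) (dy g) sequentially"
    by (auto intro!: uniform_limitI simp: dist_real_def intro: eventually_mono[OF ev])
qed

section \<open>Comparison principle on the plane\<close>

text \<open>This is the derivative of Re (log f), obtained from the norm itself so that no branch of
  the logarithm has to be chosen.\<close>

lemma ln_norm_has_derivative:
  fixes f :: "complex \<Rightarrow> complex"
  assumes "(f has_field_derivative D) (at z)" "f z \<noteq> 0"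
  shows "((\<lambda>w. ln (norm (f w))) has_derivative (\<lambda>v. Re (v * (D / f z)))) (at z)"
proof -
  have "((\<lambda>w. ln (norm (f w))) has_derivative (\<lambda>v. inverse (norm (f z)) * inner (D * v) (sgn (f z)))) (at z)"
    using has_derivative_compose[OF has_derivative_compose[OF
          assms(1)[unfolded has_field_derivative_def] has_derivative_norm[OF assms(2)]]
        DERIV_ln[THEN has_field_derivative_imp_has_derivative]] assms(2)
    by (simp add: inner_commute)
  moreover have "inverse (norm (f z)) * inner (D * v) (sgn (f z)) = Re (v * (D / f z))" for v
  proof -
    have "D * v / f z = D * v * cnj (f z) / of_real ((norm (f z))\<^sup>2)"
      by (rule complex_div_cnj)
    then have "Re (D * v / f z) = Re (D * v * cnj (f z)) / (norm (f z))\<^sup>2"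
      by (metis Re_divide_of_real)
    moreover have "inner (D * v) (f z) = Re (D * v * cnj (f z))"
      by (simp add: inner_complex_def)
    ultimately show ?thesis
      by (simp add: sgn_div_norm divide_inverse power2_eq_square mult_ac)
  qed
  ultimately show ?thesis
    by simp
qed

text \<open>The gradient of \<open>L\<close> is encoded by the holomorphic logarithmic derivative
  \<open>q\<close>: differentiating along \<i> multiplies by \<i> inside the real part. Harmonicity
  is then \<i> * \<i> = -1.\<close>

lemma ln_norm_holomorphic:
  fixes f :: "complex \<Rightarrow> complex"
  assumes "open U" "f holomorphic_on U" "\<And>z. z \<in> U \<Longrightarrow> f z \<noteq> 0"
  defines "L \<equiv> \<lambda>w. ln (norm (f w))" and "q \<equiv> \<lambda>w. deriv f w / f w"
  shows "Ck_on k L U"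
    and "z \<in> U \<Longrightarrow> dx L z = Re (q z)" "z \<in> U \<Longrightarrow> dy L z = Re (\<i> * q z)"
    and "z \<in> U \<Longrightarrow> dx (dx L) z = Re (deriv q z)" "z \<in> U \<Longrightarrow> dy (dx L) z = Re (\<i> * deriv q z)"
    and "z \<in> U \<Longrightarrow> dx (dy L) z = Re (\<i> * deriv q z)" "z \<in> U \<Longrightarrow> dy (dy L) z = - Re (deriv q z)"
    and "z \<in> U \<Longrightarrow> lap L z = 0"
proof -
  have der: "(L has_derivative (\<lambda>v. Re (v * q w))) (at w)" if "w \<in> U" for w
    unfolding L_def q_def
    by (rule ln_norm_has_derivative) (use assms that in \<open>auto intro: holomorphic_derivI\<close>)
  have q: "q holomorphic_on U"
    unfolding q_def using assms by (intro holomorphic_intros) auto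
  have q': "((\<lambda>w. Re (c * q w)) has_derivative (\<lambda>v. Re (c * (deriv q w * v)))) (at w)"
    if "w \<in> U" for w c
    using holomorphic_derivI[OF q assms(1) that]
    by (auto intro!: derivative_eq_intros simp: has_field_derivative_def)
  have Ck: "Ck_on m (\<lambda>w. Re (c * q w)) U" for m c
    using Ck_on_bounded_linear[OF bounded_linear_Re assms(1) Ck_on_mult[OF assms(1) Ck_on_const Ck_on_holomorphic[OF assms(1) q]]]
    by blast
  have "Ck_on (Suc k) L U"
    using Ck[of _ 1] Ck[of _ "\<i>"] by (intro Ck_on_SucI[OF assms(1) der]) auto
  then show "Ck_on k L U"
    by (rule Ck_on_Suc_imp)
  show d: "z \<in> U \<Longrightarrow> dx L z = Re (q z)" "z \<in> U \<Longrightarrow> dy L z = Re (\<i> * q z)" for z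
    using dx_dy_eq[OF der] by auto
  have eq: "dx L w = Re (1 * q w)" "dy L w = Re (\<i> * q w)" if "w \<in> U" for w
    using d[OF that] by simp_all
  show dd: "dx (dx L) z = Re (deriv q z)" "dy (dx L) z = Re (\<i> * deriv q z)"
    "dx (dy L) z = Re (\<i> * deriv q z)" "dy (dy L) z = - Re (deriv q z)" if "z \<in> U"
    using dx_dy_cong_open[OF assms(1) that eq(1)] dx_dy_cong_open[OF assms(1) that eq(2)]
      dx_dy_eq[OF q'[OF that, of 1]] dx_dy_eq[OF q'[OF that, of \<i>]]
    by simp_all
  show "z \<in> U \<Longrightarrow> lap L z = 0"
    by (simp add: lap_def dd)
qed

text \<open>The growth of \<open>e\<close> is beaten by the harmonic function \<open>\<epsilon> ln |z|\<close>, so a positive supremum of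
  \<open>e\<close> would be attained in the closed unit disc.\<close>

lemma comparison_plane:
  assumes C2: "Ck_on 2 e UNIV"
    and lap: "\<And>z. e z > 0 \<Longrightarrow> lap e z > 0"
    and growth: "\<And>\<epsilon>. \<epsilon> > 0 \<Longrightarrow> \<forall>\<^sub>F z in at_infinity. e z \<le> \<epsilon> * ln (norm z)"
  shows "e z \<le> 0"
proof -
  have "continuous_on UNIV e"
    using C2 Ck_on_mono[of 2 e UNIV 0] by simp
  then have cont: "continuous_on A e" for A
    by (rule continuous_on_subset) simp
  have ln_C2: "Ck_on 2 (\<lambda>z. ln (norm z)) (- {0::complex})"
    by (rule ln_norm_holomorphic[where f = "\<lambda>z. z"]) (auto intro: holomorphic_intros)
  have ln_lap: "lap (\<lambda>z. ln (norm z)) z = 0" if "z \<noteq> 0" for z :: complex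
    by (rule ln_norm_holomorphic[where f = "\<lambda>z. z" and U = "- {0}"])
       (use that in \<open>auto intro: holomorphic_intros\<close>)
  obtain z1 where z1: "z1 \<in> cball 0 1" "\<And>z. z \<in> cball 0 1 \<Longrightarrow> e z \<le> e z1"
    using continuous_attains_sup[of "cball (0::complex) 1" e] cont by auto
  \<comment> \<open>Truncation at 0 ensures that, outside the unit disc, \<open>e\<close> is
    positive wherever \<open>g\<close> below is, so that the hypothesis on the Laplacian applies
    there.\<close>
  define M where "M = max 0 (e z1)"
  have outside: "e z \<le> M + \<epsilon> * ln (norm z)" if "\<epsilon> > 0" "norm z > 1" for \<epsilon> z
  proof (rule ccontr)
    define g where "g z = e z - M - \<epsilon> * ln (norm z)" for z
    assume "\<not> ?thesis"
    then have "g z > 0"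
      by (simp add: g_def)
    obtain R where R: "\<And>z. norm z \<ge> R \<Longrightarrow> e z \<le> \<epsilon> * ln (norm z)"
      using growth[OF \<open>\<epsilon> > 0\<close>] unfolding eventually_at_infinity by blast
    have "M \<ge> 0"
      by (simp add: M_def)
    have g_out: "g z \<le> 0" if "norm z = 1 \<or> norm z \<ge> R" for z
      using that z1(2)[of z] R[of z] \<open>M \<ge> 0\<close> by (auto simp: g_def M_def)
    \<comment> \<open>Since \<open>g\<close> is nonpositive on the unit circle and from radius
      \<open>R\<close> on, a positive maximum over this closed annulus is attained in its interior,
      where \<open>g\<close> and \<open>e\<close> have the same Laplacian.\<close>
    define S where "S = cball 0 R - ball (0::complex) 1"
    have "z \<in> S"
      using \<open>norm z > 1\<close> \<open>g z > 0\<close> g_out[of z] by (force simp: S_def)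
    have "compact S"
      by (simp add: S_def compact_diff)
    moreover have "continuous_on S g"
      unfolding g_def by (intro continuous_intros cont) (auto simp: S_def)
    ultimately obtain p where p: "p \<in> S" "\<And>y. y \<in> S \<Longrightarrow> g y \<le> g p"
      using continuous_attains_sup[of S g] \<open>z \<in> S\<close> by auto
    have "g p > 0"
      using p(2)[OF \<open>z \<in> S\<close>] \<open>g z > 0\<close> by simp
    define U where "U = ball 0 R - cball (0::complex) 1"
    have "open U"
      by (simp add: U_def open_Diff)
    have "p \<in> U"
      using p(1) g_out[of p] \<open>g p > 0\<close> by (force simp: U_def S_def)
    have "U \<subseteq> S" "U \<subseteq> - {0}"
      by (auto simp: U_def S_def)
    note lnU = Ck_on_subset[OF ln_C2 \<open>U \<subseteq> - {0}\<close>]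
    have C2ln: "Ck_on 2 (\<lambda>z. \<epsilon> * ln (norm z)) U"
      by (intro Ck_on_mult Ck_on_const \<open>open U\<close> lnU)
    have C2e: "Ck_on 2 e U"
      using C2 by (rule Ck_on_subset) simp
    have C2M: "Ck_on 2 (\<lambda>z. e z - M) U"
      by (intro Ck_on_diff \<open>open U\<close> C2e Ck_on_const)
    have "Ck_on 2 g U"
      unfolding g_def by (intro Ck_on_diff \<open>open U\<close> C2M C2ln)
    then have "lap g p \<le> 0"
      using lap_nonpos_at_max[OF \<open>open U\<close> \<open>p \<in> U\<close>] p(2) \<open>U \<subseteq> S\<close> by blast
    moreover have "lap g p = lap e p - lap (\<lambda>z. M) p - lap (\<lambda>z. \<epsilon> * ln (norm z)) p"
      unfolding g_def
      by (simp add: lap_diff[OF \<open>open U\<close> \<open>p \<in> U\<close> C2M C2ln] lap_diff[OF \<open>open U\<close> \<open>p \<in> U\<close> C2e Ck_on_const])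
    moreover have "lap (\<lambda>z. M) p = 0"
      by (simp add: lap_def dx_dy_const)
    moreover have "lap (\<lambda>z. \<epsilon> * ln (norm z)) p = \<epsilon> * lap (\<lambda>z. ln (norm z)) p"
      using second_cmult[OF \<open>open U\<close> \<open>p \<in> U\<close> lnU] by (simp add: lap_def distrib_left)
    moreover have "lap (\<lambda>z. ln (norm z)) p = 0"
      using ln_lap[of p] \<open>p \<in> U\<close> \<open>U \<subseteq> - {0}\<close> by auto
    moreover have "e p > 0"
    proof -
      have "\<epsilon> * ln (norm p) > 0"
        using \<open>p \<in> U\<close> \<open>\<epsilon> > 0\<close> by (intro mult_pos_pos ln_gt_zero) (auto simp: U_def)
      then show ?thesis
        using \<open>g p > 0\<close> \<open>M \<ge> 0\<close> by (simp add: g_def)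
    qed
    ultimately show False
      using lap[of p] by simp
  qed
  have M: "e z \<le> M" for z
  proof (cases "norm z \<le> 1")
    case True
    then show ?thesis
      using z1(2)[of z] by (simp add: M_def)
  next
    case False
    then have "ln (norm z) > 0"
      by (intro ln_gt_zero) simp
    show ?thesis
    \<comment> \<open>At a fixed \<open>z\<close> the harmonic term is made as small as desired, by
      \<epsilon> = d / ln |z|.\<close>
    proof (rule field_le_epsilon)
      fix d :: real assume "d > 0"
      then show "e z \<le> M + d"
        using outside[of "d / ln (norm z)" z] False \<open>ln (norm z) > 0\<close> by auto
    qed
  qed
  show ?thesis
  proof (rule ccontr)
    \<comment> \<open>A positive supremum is a global maximum at \<open>z1\<close>, where the
      Laplacian would be both positive and nonpositive.\<close>
    assume "\<not> e z \<le> 0"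
    then have "M = e z1" "e z1 > 0"
      using M[of z] by (auto simp: M_def max_def split: if_splits)
    then show False
      using lap[of z1] lap_nonpos_at_max[OF open_UNIV UNIV_I C2, of z1] M by auto
  qed
qed

section \<open>Scalar equation and growth of a diagonal harmonic metric\<close>

lemma mat2_nth [simp]:
  "mat2 a b c d $ 1 $ 1 = a" "mat2 a b c d $ 1 $ 2 = b"
  "mat2 a b c d $ 2 $ 1 = c" "mat2 a b c d $ 2 $ 2 = d"
  by (simp_all add: mat2_def)

lemma mat2_eq_iff:
  "A = mat2 a b c d \<longleftrightarrow> A $ 1 $ 1 = a \<and> A $ 1 $ 2 = b \<and> A $ 2 $ 1 = c \<and> A $ 2 $ 2 = d"
  by (auto simp: vec_eq_iff forall_2)

lemma matrix_mult_nth_2: "(A ** B) $ i $ j = A $ i $ 1 * B $ 1 $ j + A $ i $ 2 * B $ 2 $ j"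
  for A B :: "complex^2^2"
  by (simp add: matrix_matrix_mult_def sum_2)

lemma matrix_inv_mat2_diag:
  assumes "a \<noteq> 0" "d \<noteq> 0"
  shows "matrix_inv (mat2 a 0 0 d) = mat2 (inverse a) 0 0 (inverse d)"
proof -
  have 1: "mat2 a 0 0 d ** mat2 (inverse a) 0 0 (inverse d) = mat 1"
    "mat2 (inverse a) 0 0 (inverse d) ** mat2 a 0 0 d = mat 1"
    using assms by (auto simp: vec_eq_iff forall_2 matrix_mult_nth_2 mat_def)
  let ?I = "matrix_inv (mat2 a 0 0 d)"
  have "mat2 a 0 0 d ** ?I = mat 1 \<and> ?I ** mat2 a 0 0 d = mat 1"
    unfolding matrix_inv_def by (rule someI[of _ "mat2 (inverse a) 0 0 (inverse d)"]) (use 1 in auto)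
  then show ?thesis
    using 1 by (metis matrix_mul_assoc matrix_mul_lid matrix_mul_rid)
qed

text \<open>The complement of a finite set is dense. This carries identities between entries of the
  metric across the zeros of z^3 + u, where the diagonal formula is not given.\<close>

lemma continuous_eq_off_finite:
  fixes f :: "complex \<Rightarrow> complex"
  assumes "continuous_on UNIV f" "finite Z" "\<And>z. z \<notin> Z \<Longrightarrow> f z = c"
  shows "f z = c"
proof -
  have "closed {z. f z = c}"
    using assms(1) by (intro closed_Collect_eq) auto
  moreover have "- Z \<subseteq> {z. f z = c}"
    using assms(3) by auto
  ultimately have "closure (- Z) \<subseteq> {z. f z = c}"
    by (simp add: closure_minimal)
  then show ?thesis
    using empty_interior_finite[OF assms(2)] by (auto simp: closure_complement)
qed

lemma finite_zeros: "finite {z::complex. z ^ 3 + u = 0}"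
proof -
  have "{z. z ^ 3 + u = 0} = {z. poly [:u, 0, 0, 1:] z = 0}"
    by (auto simp: power3_eq_cube algebra_simps)
  then show ?thesis
    using poly_roots_finite[of "[:u, 0, 0, 1:]"] by simp
qed

text \<open>The growth rate is an infimum that need not be attained, hence the margin \<epsilon>;
  the strict gain in the exponent also swallows the Landau constant.\<close>

lemma growth_rate_bound:
  assumes "growth_rate f = ereal a" "\<epsilon> > 0"
  shows "\<forall>\<^sub>F z in at_infinity. \<bar>f z\<bar> \<le> norm z powr (a + \<epsilon>)"
proof -
  have "growth_rate f < ereal (a + \<epsilon>)"
    using assms by simp
  then obtain b where b: "b < a + \<epsilon>" "f \<in> O[at_infinity](\<lambda>z. norm z powr b)"
    unfolding growth_rate_def Inf_less_iff by auto
  have "(\<lambda>z::complex. norm z powr b) \<in> o[at_infinity](\<lambda>z. norm z powr (a + \<epsilon>))"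
    using b(1) by (subst powr_smallo_iff) (use trivial_limit_at_infinity in \<open>auto intro: filterlim_norm_at_top simp: trivial_limit_def\<close>)
  with b(2) have "f \<in> o[at_infinity](\<lambda>z. norm z powr (a + \<epsilon>))"
    by (rule landau_o.big_small_trans)
  from landau_o.smallD[OF this zero_less_one] show ?thesis
    by simp
qed

lemma pole_order_const:
  "pole_order_at_infinity (\<lambda>z. c) = (if c = 0 then -\<infinity> else 0)"
  using trivial_limit_at_infinity
  by (auto simp: pole_order_at_infinity_def zero_ereal_def trivial_limit_def)

text \<open>The zero component has order -\<infinity> and drops out of the maximum.\<close>

lemma filtered_order_axis: "filtered_order \<alpha> (\<lambda>z. axis i 1) = ereal (- \<alpha> $ i)"
  using exhaust_2[of i]
  by (auto simp: filtered_order_def UNIV_2 axis_def pole_order_const max_def)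

text \<open>Adaptedness is tested on the constant frame sections. For a diagonal metric of
  determinant 1 their norms are reciprocal, so two upper bounds give two-sided control.\<close>

lemma adapted_axis:
  assumes "adapted \<alpha> h"
  shows "growth_rate (metric_norm h (\<lambda>z. axis i 1)) = ereal (- \<alpha> $ i)"
  using assms unfolding adapted_def filtered_order_axis[symmetric]
  by (auto simp: meromorphic_at_infinity_def intro!: meromorphic_intros)

lemma metric_norm_axis: "metric_norm h (\<lambda>z. axis i 1) z = sqrt (Re (gram h z $ i $ i))"
  using exhaust_2[of i] by (auto simp: metric_norm_def sesq_def sum_2 axis_def)

lemma Ck_on_nth: "Ck_on k h UNIV \<Longrightarrow> Ck_on k (\<lambda>z. h z $ i $ j) UNIV"
  for h :: "complex \<Rightarrow> complex^2^2"
  by (rule Ck_on_bounded_linear[OF bounded_linear_compose[OF bounded_linear_vec_nth bounded_linear_vec_nth]])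
    auto

section \<open>Wirtinger derivatives of real-valued functions\<close>

lemma d_z_of_real:
  fixes f :: "complex \<Rightarrow> real"
  assumes "f differentiable (at z)"
  shows "d_z (\<lambda>w. complex_of_real (f w)) z = (of_real (dx f z) - \<i> * of_real (dy f z)) / 2"
    and "d_zbar (\<lambda>w. complex_of_real (f w)) z = (of_real (dx f z) + \<i> * of_real (dy f z)) / 2"
  using dx_dy_eq[OF has_derivative_of_real[OF has_derivative_dx_dy[OF assms], where 'a = complex]]
  by (simp_all add: d_z_def d_zbar_def)

text \<open>For \<open>c\<close> equal to \<i> or -\<i>, and \<open>f\<close>, \<open>g\<close> the
  partial derivatives of a real function, \<open>F\<close> is a Wirtinger derivative; this reduces
  second Wirtinger derivatives to real ones.\<close>

lemma Complex_comb_dx_dy: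
  fixes f g :: "complex \<Rightarrow> real" and c :: complex
  assumes "f differentiable (at z)" "g differentiable (at z)"
  defines "F \<equiv> \<lambda>w. (complex_of_real (f w) + c * complex_of_real (g w)) / 2"
  shows "dx F z = (of_real (dx f z) + c * of_real (dx g z)) / 2"
    and "dy F z = (of_real (dy f z) + c * of_real (dy g z)) / 2"
proof -
  have "(F has_derivative (\<lambda>v. (of_real (Re v *\<^sub>R dx f z + Im v *\<^sub>R dy f z)
      + c * of_real (Re v *\<^sub>R dx g z + Im v *\<^sub>R dy g z)) / 2)) (at z)"
    unfolding F_def
    by (intro bounded_linear.has_derivative[OF bounded_linear_divide] has_derivative_add
        has_derivative_mult_right has_derivative_of_real has_derivative_dx_dy assms)
  from dx_dy_eq[OF this] show "dx F z = (of_real (dx f z) + c * of_real (dx g z)) / 2"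
    "dy F z = (of_real (dy f z) + c * of_real (dy g z)) / 2"
    by simp_all
qed

lemma laplacian_of_real:
  assumes "open U" "z \<in> U" "Ck_on 2 f U"
  shows "laplacian (\<lambda>w. of_real (f w)) z = of_real (lap f z)"
proof -
  have diff: "f differentiable (at w)" "dx f differentiable (at w)" "dy f differentiable (at w)"
    if "w \<in> U" for w
    using that assms(3) by (auto simp: numeral_2_eq_2)
  note cong = dx_dy_cong_open[OF assms(1,2), of "d_zbar (\<lambda>w. of_real (f w))",
      OF d_z_of_real(2)[OF diff(1)]]
  show ?thesis
    unfolding laplacian_def d_z_def
    by (simp add: cong Complex_comb_dx_dy[OF diff(2,3)] assms(2) dx_dy_commute[OF assms] lap_def complex_eq_iff)
qed

text \<open>The entry \<open>h z $ 1 $ 1\<close> is smooth and positive at the zeros of z^3 + u as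
  well. By continuity \<open>h z\<close> is diagonal with determinant 1 on the whole plane, so it is
  determined by \<open>W\<close>, and Hitchin's equation becomes a scalar equation without
  singularities.\<close>

lemma harmonic_metric_diag:
  fixes u :: complex and h :: "complex \<Rightarrow> complex^2^2" and \<psi> :: "complex \<Rightarrow> real"
  assumes harm: "harmonic_metric \<kappa> weights (higgs_field u) h"
    and h: "\<And>z. z^3 + u \<noteq> 0 \<Longrightarrow>
           h z = mat2 (of_real (norm (z^3 + u) powr (1/2) * exp (\<psi> z))) 0
                      0 (of_real (norm (z^3 + u) powr (-1/2) * exp (- \<psi> z)))"
  defines "W \<equiv> \<lambda>z. ln (Re (h z $ 1 $ 1))"
  shows harmonic_psi: "z^3 + u \<noteq> 0 \<Longrightarrow> \<psi> z = W z - 1/2 * ln (norm (z^3 + u))"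
    and harmonic_Ck: "Ck_on k W UNIV"
    and harmonic_lap: "lap W z
          = 4 * \<kappa> * (exp (2 * W z) - (norm (z^3 + u))\<^sup>2 * exp (- 2 * W z))"
    and harmonic_growth: "\<epsilon> > 0 \<Longrightarrow>
          \<forall>\<^sub>F z in at_infinity. \<bar>W z - 3/2 * ln (norm z)\<bar> \<le> \<epsilon> * ln (norm z)"
proof -
  have smooth: "pos_def_hermitian (h z)" "Ck_on k h UNIV" for z k
    using harm by (auto simp: harmonic_metric_def smooth_hermitian_metric_def)
  have cont: "continuous_on UNIV (\<lambda>z. h z $ i $ j)" for i j
    using Ck_on_nth[OF smooth(2)[of 0]] by simp
  have pos: "Re (h z $ 1 $ 1) > 0" and real: "Im (h z $ 1 $ 1) = 0" for z
  proof -
    have "Re (sesq (h z) (axis 1 1) (axis 1 1)) > 0"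
      using smooth(1)[of z] by (auto simp: pos_def_hermitian_def)
    then show "Re (h z $ 1 $ 1) > 0"
      by (simp add: sesq_def sum_2 axis_def)
    have "dagger (h z) $ 1 $ 1 = h z $ 1 $ 1"
      using smooth(1)[of z] by (simp add: pos_def_hermitian_def)
    then show "Im (h z $ 1 $ 1) = 0"
      by (simp add: dagger_def complex_eq_iff)
  qed
  have off: "h z $ 1 $ 2 = 0" "h z $ 2 $ 1 = 0" for z
    by (rule continuous_eq_off_finite[OF cont finite_zeros[of u]], simp add: h)+
  have "h z $ 1 $ 1 * h z $ 2 $ 2 = 1" if "z^3 + u \<noteq> 0" for z
  proof -
    have "norm (z^3 + u) powr (1/2) * exp (\<psi> z) * (norm (z^3 + u) powr (-1/2) * exp (- \<psi> z))
        = norm (z^3 + u) powr (1/2 + -1/2) * exp (\<psi> z + - \<psi> z)"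
      unfolding powr_add exp_add by (simp only: mult_ac)
    also have "\<dots> = 1"
      using that by simp
    finally show ?thesis
      unfolding h[OF that] mat2_nth of_real_mult[symmetric] by simp
  qed
  then have det: "h z $ 1 $ 1 * h z $ 2 $ 2 = 1" for z
    by (rule continuous_eq_off_finite[OF continuous_on_mult[OF cont cont] finite_zeros[of u]]) simp
  have h11: "h z $ 1 $ 1 = of_real (exp (W z))" for z
    using pos[of z] real[of z] by (simp add: W_def complex_eq_iff)
  have h22: "h z $ 2 $ 2 = of_real (exp (- W z))" for z
    using det[of z] unfolding h11 by (simp add: exp_minus field_simps)
  have hW: "h z = mat2 (of_real (exp (W z))) 0 0 (of_real (exp (- W z)))" for z
    by (simp add: mat2_eq_iff off h11 h22)
  have gram: "gram h z = mat2 (of_real (exp (- W z))) 0 0 (of_real (exp (W z)))" for z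
    by (simp add: gram_def hW matrix_inv_mat2_diag exp_minus del: of_real_exp)
  show "\<psi> z = W z - 1/2 * ln (norm (z^3 + u))" if "z^3 + u \<noteq> 0" for z
    using that by (simp add: W_def h ln_mult ln_powr)
  have "Ck_on k (\<lambda>z. Re (h z $ 1 $ 1)) UNIV" for k
    by (intro Ck_on_bounded_linear[OF bounded_linear_Re] Ck_on_nth smooth open_UNIV)
  then show Ck: "Ck_on k W UNIV" for k
    unfolding W_def by (rule Ck_on_ln[OF open_UNIV pos])
  have diff: "W differentiable (at z)" "dx W differentiable (at z)" "dy W differentiable (at z)" for z
    using Ck[of 2] by (auto simp: numeral_2_eq_2)
  have "dx (\<lambda>z. exp (W z)) z = exp (W z) * dx W z \<and> dy (\<lambda>z. exp (W z)) z = exp (W z) * dy W z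
      \<and> (\<lambda>z. exp (W z)) differentiable (at z)" for z
  proof -
    have "((\<lambda>z. exp (W z)) has_derivative (\<lambda>v. exp (W z) * (Re v *\<^sub>R dx W z + Im v *\<^sub>R dy W z))) (at z)"
      by (auto intro!: derivative_eq_intros has_derivative_dx_dy diff)
    from dx_dy_eq[OF this] this show ?thesis
      unfolding differentiable_def by auto
  qed
  \<comment> \<open>The Gram matrix is the inverse of \<open>h z\<close>, so its lower right entry
    is \<open>exp (W z)\<close>, and this entry of the connection form is the z-derivative of
    \<open>W\<close> without a sign.\<close>
  then have chern: "chern_form h z $ 2 $ 2 = (of_real (dx W z) + (- \<i>) * of_real (dy W z)) / 2" for z
    by (simp add: chern_form_def gram matrix_inv_mat2_diag matrix_mult_nth_2 d_z_of_real
        exp_minus field_simps del: of_real_exp)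
  \<comment> \<open>The mixed second derivatives carry a factor \<i> and vanish in the real
    part.\<close>
  have curv: "Re (curvature h z $ 2 $ 2) = - lap W z / 4" for z
    unfolding curvature_def d_zbar_def vec_lambda_beta chern Complex_comb_dx_dy[OF diff(2) diff(3)]
    by (simp add: lap_def field_simps)
  have e2: "exp (2 * W z) = exp (W z) * exp (W z)" "exp (- 2 * W z) = exp (- W z) * exp (- W z)" for z
    by (simp_all flip: exp_add)
  have adj: "adjoint_wrt (h z) (higgs_field u z)
      = mat2 0 (of_real (exp (2 * W z))) (cnj (z^3 + u) * of_real (exp (- 2 * W z))) 0" for z
    unfolding adjoint_wrt_def gram[unfolded gram_def] unfolding hW e2
    by (simp add: mat2_eq_iff matrix_mult_nth_2 dagger_def higgs_field_def mult_ac del: of_real_exp)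
  have bracket: "higgs_bracket h (higgs_field u) z $ 2 $ 2
      = of_real (exp (2 * W z) - (norm (z^3 + u))\<^sup>2 * exp (- 2 * W z))" for z
    unfolding higgs_bracket_def adj
    using complex_norm_square[of "z^3 + u"]
    by (simp add: matrix_mult_nth_2 higgs_field_def mult_ac)
  show "lap W z = 4 * \<kappa> * (exp (2 * W z) - (norm (z^3 + u))\<^sup>2 * exp (- 2 * W z))"
  proof -
    have "curvature h z + \<kappa> *\<^sub>R higgs_bracket h (higgs_field u) z = 0"
      using harm by (simp add: harmonic_metric_def)
    then have "Re ((curvature h z + \<kappa> *\<^sub>R higgs_bracket h (higgs_field u) z) $ 2 $ 2) = 0"
      by simp
    then show ?thesis
      by (simp add: curv bracket)
  qed
  show "\<forall>\<^sub>F z in at_infinity. \<bar>W z - 3/2 * ln (norm z)\<bar> \<le> \<epsilon> * ln (norm z)" if "\<epsilon> > 0"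
  proof -
    have norm_eq: "metric_norm h (\<lambda>z. axis 1 1) z = exp (- W z / 2)"
      "metric_norm h (\<lambda>z. axis 2 1) z = exp (W z / 2)" for z
      by (auto simp: metric_norm_axis gram real_sqrt_unique power2_eq_square exp_add[symmetric]
          simp del: of_real_exp)
    have "adapted weights h"
      using harm by (simp add: harmonic_metric_def)
    \<comment> \<open>The norms of the frame sections are exp (- W / 2) and exp (W / 2), so a margin
      \<epsilon> / 2 in the exponent becomes \<epsilon> for \<open>W\<close>.\<close>
    note growth = growth_rate_bound[OF adapted_axis[OF this], of "\<epsilon> / 2"]
    have "\<forall>\<^sub>F z in at_infinity. exp (- W z / 2) \<le> norm z powr (- 3/4 + \<epsilon> / 2)"
      "\<forall>\<^sub>F z in at_infinity. exp (W z / 2) \<le> norm z powr (3/4 + \<epsilon> / 2)"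
      using growth[of 1] growth[of 2] that by (simp_all add: norm_eq weights_def)
    moreover have "\<forall>\<^sub>F z in at_infinity. norm (z::complex) > 0"
      unfolding eventually_at_infinity by (rule exI[of _ 1]) auto
    ultimately show ?thesis
    proof eventually_elim
      case (elim z)
      then have "exp (- W z / 2) \<le> exp ((- 3/4 + \<epsilon> / 2) * ln (norm z))"
        "exp (W z / 2) \<le> exp ((3/4 + \<epsilon> / 2) * ln (norm z))"
        by (simp_all add: powr_def)
      then show ?case
        unfolding exp_le_cancel_iff by (simp add: abs_le_iff algebra_simps)
    qed
  qed
qed

section \<open>Dependence of the scalar equation on the parameter\<close>

text \<open>Meant for A = exp (2 V0), B = exp (2 V), t = exp (2 \<delta>), with \<open>q\<close> and
  \<open>p\<close> the squared moduli. As x - p / x increases in x, it may be evaluated at x = t A,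
  that is at V0 + \<delta>; the last hypothesis is the supersolution inequality there, cleared of
  denominators.\<close>

lemma perturb_ineq_upper:
  fixes A B p q t :: real
  assumes "A > 0" "t > 1" "p \<ge> 0" "t * A < B" and p: "p \<le> t * q + t * (t - 1) * A\<^sup>2"
  shows "A - q / A < B - p / B"
proof -
  have "t * A > 0"
    using assms by simp
  have "A - q / A = t * A - (t * q + t * (t - 1) * A\<^sup>2) / (t * A)"
    using assms by (simp add: field_simps power2_eq_square)
  also have "\<dots> \<le> t * A - p / (t * A)"
    using p \<open>t * A > 0\<close> by (intro diff_left_mono divide_right_mono) auto
  also have "\<dots> < B - p / B"
    using divide_left_mono[of "t * A" B p] \<open>t * A > 0\<close> assms by (auto simp: mult_pos_pos)
  finally show ?thesis .
qed

text \<open>Mirror image with x = A / t, that is V0 - \<delta>; the last hypothesis is now the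
  subsolution inequality.\<close>

lemma perturb_ineq_lower:
  fixes A B p q t :: real
  assumes "A > 0" "t > 1" "p \<ge> 0" "B > 0" "t * B < A" and q: "q \<le> t * p + (1 - 1 / t) * A\<^sup>2"
  shows "B - p / B < A - q / A"
proof -
  have "B < A / t"
    using assms by (simp add: field_simps)
  then have "B - p / B < A / t - p / (A / t)"
    using divide_left_mono[of B "A / t" p] assms by (auto simp: mult_pos_pos)
  also have "\<dots> = A - (t * p + (1 - 1 / t) * A\<^sup>2) / A"
    using assms by (simp add: field_simps power2_eq_square)
  also have "\<dots> \<le> A - q / A"
    using q assms(1) by (intro diff_left_mono divide_right_mono) auto
  finally show ?thesis .
qed

text \<open>Weighted inequality 2 a s \<le> (t - 1) a^2 + s^2 / (t - 1). The factor \<open>t\<close>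
  on the unbounded term leaves an error that depends only on \<open>s\<close> and
  \<open>t\<close>.\<close>

lemma Young_square:
  fixes a b s t :: real
  assumes "t > 1" "0 \<le> b" "0 \<le> a" "b \<le> a + s" "0 \<le> s"
  shows "b\<^sup>2 \<le> t * a\<^sup>2 + t / (t - 1) * s\<^sup>2"
proof -
  have "b\<^sup>2 \<le> (a + s)\<^sup>2"
    using assms by (intro power_mono) auto
  also have "t * a\<^sup>2 + t / (t - 1) * s\<^sup>2 - (a + s)\<^sup>2 = ((t - 1) * a - s)\<^sup>2 / (t - 1)"
    using assms(1) by (simp add: field_simps power2_eq_square)
  then have "(a + s)\<^sup>2 \<le> t * a\<^sup>2 + t / (t - 1) * s\<^sup>2"
    using assms(1) by (smt (verit) divide_nonneg_pos zero_le_power2)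
  finally show ?thesis .
qed

text \<open>Outside a large disc the hypothesis gives V \<ge> ln |z| / 2 \<ge> 0, and on the disc
  \<open>V\<close> has a minimum.\<close>

lemma exp_ge_positive_of_growth:
  fixes V :: "complex \<Rightarrow> real"
  assumes cont: "continuous_on UNIV V"
    and growth: "\<forall>\<^sub>F z in at_infinity. \<bar>V z - 3/2 * ln (norm z)\<bar> \<le> ln (norm z)"
  shows "\<exists>m>0. \<forall>z. m \<le> exp (2 * V z)"
proof -
  obtain R where R: "\<And>z. norm z \<ge> R \<Longrightarrow> \<bar>V z - 3/2 * ln (norm z)\<bar> \<le> ln (norm z)"
    using growth unfolding eventually_at_infinity by blast
  obtain p where p: "\<And>z. z \<in> cball 0 (max R 1) \<Longrightarrow> V p \<le> V z"
    using continuous_attains_inf[of "cball (0::complex) (max R 1)" V]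
      continuous_on_subset[OF cont] by force
  have "min 0 (V p) \<le> V z" for z
  proof (cases "norm z \<le> max R 1")
    case True
    then show ?thesis
      using p[of z] by simp
  next
    case False
    then have "ln (norm z) \<ge> 0" "norm z \<ge> R"
      by auto
    then show ?thesis
      using R[of z] unfolding abs_le_iff by linarith
  qed
  then show ?thesis
    by (intro exI[of _ "exp (2 * min 0 (V p))"]) auto
qed

text \<open>Wherever V - V0 exceeds \<delta>, the shifted difference has positive Laplacian, and
  likewise with the roles exchanged, so the comparison principle applies to both. The smallness
  asked of \<open>s\<close> involves only \<delta> and \<open>m\<close> and not the point.\<close>

lemma sup_norm_estimate:
  fixes V V0 p q :: "complex \<Rightarrow> real"
  assumes C2: "Ck_on 2 V UNIV" "Ck_on 2 V0 UNIV" and "c > 0" "\<delta> > 0" "s \<ge> 0"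
    and p: "\<And>z. p z \<ge> 0" "\<And>z. q z \<ge> 0" "\<And>z. \<bar>p z - q z\<bar> \<le> s"
    and V: "\<And>z. lap V z = c * (exp (2 * V z) - (p z)\<^sup>2 * exp (- 2 * V z))"
    and V0: "\<And>z. lap V0 z = c * (exp (2 * V0 z) - (q z)\<^sup>2 * exp (- 2 * V0 z))"
    and growth: "\<And>\<epsilon>. \<epsilon> > 0 \<Longrightarrow> \<forall>\<^sub>F z in at_infinity. \<bar>V z - V0 z\<bar> \<le> \<epsilon> * ln (norm z)"
    and m: "m > 0" "\<And>z. m \<le> exp (2 * V0 z)" and s: "s \<le> (1 - exp (- 2 * \<delta>)) * m"
  shows "\<bar>V z - V0 z\<bar> \<le> \<delta>"
proof -
  define t where "t = exp (2 * \<delta>)"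
  have "t > 1"
    using \<open>\<delta> > 0\<close> by (simp add: t_def)
  have s': "s \<le> (1 - 1 / t) * m"
    using s by (simp add: t_def exp_minus field_simps)
  \<comment> \<open>The bound on \<open>s\<close> is tuned so that t / (t - 1) * (1 - 1 / t)^2
    collapses to 1 - 1 / t. The second margin is the larger one, since 1 - 1 / t = (t - 1) /
    t.\<close>
  have small: "t / (t - 1) * s\<^sup>2 \<le> (1 - 1 / t) * (exp (2 * V0 z))\<^sup>2"
    "t / (t - 1) * s\<^sup>2 \<le> t * (t - 1) * (exp (2 * V0 z))\<^sup>2" for z
  proof -
    have "t / (t - 1) * s\<^sup>2 \<le> t / (t - 1) * ((1 - 1 / t) * m)\<^sup>2"
      using s' \<open>s \<ge> 0\<close> \<open>t > 1\<close> by (intro mult_left_mono power_mono) auto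
    also have "\<dots> = (1 - 1 / t) * m\<^sup>2"
      using \<open>t > 1\<close> by (simp add: field_simps power2_eq_square)
    also have "\<dots> \<le> (1 - 1 / t) * (exp (2 * V0 z))\<^sup>2"
      using m \<open>t > 1\<close> by (intro mult_left_mono power_mono) (auto intro: less_imp_le)
    finally show 1: "t / (t - 1) * s\<^sup>2 \<le> (1 - 1 / t) * (exp (2 * V0 z))\<^sup>2" .
    have "1 - 1 / t = (t - 1) / t"
      using \<open>t > 1\<close> by (simp add: field_simps)
    also have "\<dots> \<le> t * (t - 1)"
    proof -
      have "(t - 1) * 1 \<le> (t - 1) * (t * t)"
        using \<open>t > 1\<close> by (intro mult_left_mono) (auto simp: less_1_mult less_imp_le)
      then show ?thesis
        using \<open>t > 1\<close> by (simp add: field_simps)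
    qed
    finally show "t / (t - 1) * s\<^sup>2 \<le> t * (t - 1) * (exp (2 * V0 z))\<^sup>2"
      using 1 by (meson mult_right_mono order_trans zero_le_power2)
  qed
  have close: "(p z)\<^sup>2 \<le> t * (q z)\<^sup>2 + t / (t - 1) * s\<^sup>2" "(q z)\<^sup>2 \<le> t * (p z)\<^sup>2 + t / (t - 1) * s\<^sup>2" for z
    by (rule Young_square[OF \<open>t > 1\<close> p(1,2)] Young_square[OF \<open>t > 1\<close> p(2,1)];
        use p(3)[of z] \<open>s \<ge> 0\<close> in simp)+
  have lap': "lap (\<lambda>z. f z - g z - \<delta>) z = lap f z - lap g z"
    if "Ck_on 2 f UNIV" "Ck_on 2 g UNIV" for f g z
    using lap_diff[OF open_UNIV UNIV_I that]
      lap_diff[OF open_UNIV UNIV_I Ck_on_diff[OF open_UNIV that] Ck_on_const]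
    by (simp add: lap_def[of "\<lambda>z. \<delta>"] dx_dy_const)
  have t_exp: "t * exp (2 * x) = exp (2 * (x + \<delta>))" for x
    by (simp add: t_def flip: exp_add)
  have "V z - V0 z - \<delta> \<le> 0"
  proof (rule comparison_plane)
    show "Ck_on 2 (\<lambda>z. V z - V0 z - \<delta>) UNIV"
      by (intro Ck_on_diff C2 Ck_on_const open_UNIV)
    show "\<forall>\<^sub>F z in at_infinity. V z - V0 z - \<delta> \<le> \<epsilon> * ln (norm z)" if "\<epsilon> > 0" for \<epsilon>
      using growth[OF that] by eventually_elim (use \<open>\<delta> > 0\<close> in auto)
    show "lap (\<lambda>z. V z - V0 z - \<delta>) z > 0" if "V z - V0 z - \<delta> > 0" for z
    proof -
      have "exp (2 * V0 z) - (q z)\<^sup>2 / exp (2 * V0 z) < exp (2 * V z) - (p z)\<^sup>2 / exp (2 * V z)"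
        by (rule perturb_ineq_upper[of _ t])
           (use \<open>t > 1\<close> that small(2)[of z] close(1)[of z] in \<open>auto simp: t_exp\<close>)
      then show ?thesis
        using \<open>c > 0\<close> by (simp add: lap' C2 V V0 exp_minus divide_inverse)
    qed
  qed
  moreover have "V0 z - V z - \<delta> \<le> 0"
  proof (rule comparison_plane)
    show "Ck_on 2 (\<lambda>z. V0 z - V z - \<delta>) UNIV"
      by (intro Ck_on_diff C2 Ck_on_const open_UNIV)
    show "\<forall>\<^sub>F z in at_infinity. V0 z - V z - \<delta> \<le> \<epsilon> * ln (norm z)" if "\<epsilon> > 0" for \<epsilon>
      using growth[OF that] by eventually_elim (use \<open>\<delta> > 0\<close> in auto)
    show "lap (\<lambda>z. V0 z - V z - \<delta>) z > 0" if "V0 z - V z - \<delta> > 0" for z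
    proof -
      have "exp (2 * V z) - (p z)\<^sup>2 / exp (2 * V z) < exp (2 * V0 z) - (q z)\<^sup>2 / exp (2 * V0 z)"
        by (rule perturb_ineq_lower[of _ t])
           (use \<open>t > 1\<close> that small(1)[of z] close(2)[of z] in \<open>auto simp: t_exp\<close>)
      then show ?thesis
        using \<open>c > 0\<close> by (simp add: lap' C2 V V0 exp_minus divide_inverse)
    qed
  qed
  ultimately show ?thesis
    by simp
qed

section \<open>Uniform limits under composition with continuous functions\<close>

lemma uniform_limit_compose_compact:
  fixes F :: "'b::metric_space \<Rightarrow> 'c::metric_space"
  assumes "uniform_limit K q q0 G" "compact B" "continuous_on B F"
    and "\<forall>\<^sub>F j in G. \<forall>z\<in>K. q j z \<in> B"
  shows "uniform_limit K (\<lambda>j z. F (q j z)) (\<lambda>z. F (q0 z)) G"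
  by (rule uniform_limit_compose_uniformly_continuous_on
      [OF assms(1) compact_uniformly_continuous[OF assms(3,2)] assms(4) compact_imp_closed[OF assms(2)]])

text \<open>Eventually all values lie in a ball one unit larger than the one containing the limit
  values, and on this compact ball \<open>F\<close> is uniformly continuous.\<close>

lemma uniform_limit_compose_bounded:
  fixes F :: "'b::{heine_borel,real_normed_vector} \<Rightarrow> 'c::metric_space"
  assumes lim: "uniform_limit K q q0 G" and "bounded (q0 ` K)" and cont: "continuous_on UNIV F"
  shows "uniform_limit K (\<lambda>j z. F (q j z)) (\<lambda>z. F (q0 z)) G"
proof -
  obtain r where r: "\<And>z. z \<in> K \<Longrightarrow> norm (q0 z) \<le> r"
    using assms(2) unfolding bounded_iff by auto
  have "\<forall>\<^sub>F j in G. \<forall>z\<in>K. q j z \<in> cball 0 (r + 1)"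
    using uniform_limitD[OF lim zero_less_one]
  proof eventually_elim
    case (elim j)
    show ?case
    proof
      fix z assume "z \<in> K"
      then have "norm (q j z) \<le> norm (q0 z) + norm (q j z - q0 z)"
        by (metis add.commute diff_add_cancel norm_triangle_ineq)
      then show "q j z \<in> cball 0 (r + 1)"
        using r[OF \<open>z \<in> K\<close>] elim \<open>z \<in> K\<close> by (force simp: dist_norm)
    qed
  qed
  then show ?thesis
    by (intro uniform_limit_compose_compact[OF lim, of "cball 0 (r + 1)"] continuous_on_subset[OF cont])
       auto
qed

lemma uniform_limit_Pair:
  assumes "uniform_limit K f f0 G" "uniform_limit K g g0 G"
  shows "uniform_limit K (\<lambda>j z. (f j z, g j z)) (\<lambda>z. (f0 z, g0 z)) G"
proof (rule uniform_limitI)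
  fix e :: real assume "e > 0"
  then have "e / 2 > 0"
    by simp
  from uniform_limitD[OF assms(1) this] uniform_limitD[OF assms(2) this]
  show "\<forall>\<^sub>F j in G. \<forall>z\<in>K. dist (f j z, g j z) (f0 z, g0 z) < e"
  proof eventually_elim
    case (elim j)
    show ?case
    proof
      fix z assume "z \<in> K"
      have "dist (f j z, g j z) (f0 z, g0 z) \<le> dist (f j z) (f0 z) + dist (g j z) (g0 z)"
        unfolding dist_Pair_Pair by (rule sqrt_sum_squares_le_sum) auto
      also have "\<dots> < e"
        using elim \<open>z \<in> K\<close> by fastforce
      finally show "dist (f j z, g j z) (f0 z, g0 z) < e" .
    qed
  qed
qed

lemma uniform_limit_param: "v \<longlonglongrightarrow> a \<Longrightarrow> uniform_limit K (\<lambda>j z. v j) (\<lambda>z. a) sequentially"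
  unfolding uniform_limit_iff tendsto_iff by auto

text \<open>Both the equation and its first derivatives express Laplacians by lower order terms,
  so two applications of the gradient estimate bootstrap locally uniform convergence.\<close>

lemma sinh_Gordon_C2_convergence:
  fixes W :: "nat \<Rightarrow> complex \<Rightarrow> real" and W0 :: "complex \<Rightarrow> real" and v :: "nat \<Rightarrow> complex"
  assumes C3: "\<And>j. Ck_on 3 (W j) UNIV" "Ck_on 3 W0 UNIV"
    and lap: "\<And>j z. lap (W j) z = c * (exp (2 * W j z) - (norm (z^3 + v j))\<^sup>2 * exp (- 2 * W j z))"
      "\<And>z. lap W0 z = c * (exp (2 * W0 z) - (norm (z^3 + a))\<^sup>2 * exp (- 2 * W0 z))"
    and v: "v \<longlonglongrightarrow> a" and lim: "\<And>K. compact K \<Longrightarrow> uniform_limit K W W0 sequentially"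
    and "compact K" and D: "D \<in> {id, dx, dy, dx \<circ> dx, dx \<circ> dy, dy \<circ> dx, dy \<circ> dy}"
  shows "uniform_limit K (\<lambda>j. D (W j)) (D W0) sequentially"
proof -
  have C2: "Ck_on 2 f UNIV" "Ck_on 2 (dx f) UNIV" "Ck_on 2 (dy f) UNIV"
    and diff: "\<And>z. f differentiable (at z)"
    and cont: "\<And>A. continuous_on A f" "\<And>A. continuous_on A (dx f)" "\<And>A. continuous_on A (dy f)"
    if "Ck_on 3 f UNIV" for f :: "complex \<Rightarrow> real"
  proof -
    show C2: "Ck_on 2 f UNIV" "Ck_on 2 (dx f) UNIV" "Ck_on 2 (dy f) UNIV"
      using that Ck_on_mono[OF that, of 2] by (auto simp: numeral_3_eq_3 numeral_2_eq_2)
    show "f differentiable (at z)" for z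
      using that by (simp add: numeral_3_eq_3)
    show "continuous_on A f" "continuous_on A (dx f)" "continuous_on A (dy f)" for A
      using C2[THEN Ck_on_mono, of 0] by (auto intro: continuous_on_subset)
  qed
  have id: "uniform_limit K (\<lambda>j z. z) (\<lambda>z. z) sequentially" for K :: "complex set"
    by (simp add: uniform_limit_iff)
  have bounded: "bounded (f ` K)" if "compact K" "continuous_on K f" for f :: "complex \<Rightarrow> 'b::metric_space" and K
    using that by (intro compact_imp_bounded compact_continuous_image)
  have lim_lap: "uniform_limit K (\<lambda>j. lap (W j)) (lap W0) sequentially" if "compact K" for K
  proof -
    \<comment> \<open>With the parameter as an argument, the right-hand sides for all
      \<open>j\<close> are instances of one continuous function, through which uniform limits
      pass.\<close>
    define H :: "complex \<times> complex \<times> real \<Rightarrow> real" where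
      "H = (\<lambda>(u, z, w). c * (exp (2 * w) - (norm (z^3 + u))\<^sup>2 * exp (- 2 * w)))"
    have "continuous_on UNIV H"
      unfolding H_def by (auto intro!: continuous_intros simp: case_prod_beta)
    moreover have "bounded ((\<lambda>z. (a, z, W0 z)) ` K)"
      by (intro bounded that continuous_intros cont C3)
    ultimately have "uniform_limit K (\<lambda>j z. H (v j, z, W j z)) (\<lambda>z. H (a, z, W0 z)) sequentially"
      by (intro uniform_limit_compose_bounded[OF uniform_limit_Pair[OF uniform_limit_param[OF v]
              uniform_limit_Pair[OF id lim[OF that]]]])
    then show ?thesis
      by (simp add: H_def lap[abs_def])
  qed
  have lim1: "uniform_limit K (\<lambda>j. dx (W j)) (dx W0) sequentially"
    "uniform_limit K (\<lambda>j. dy (W j)) (dy W0) sequentially" if "compact K" for K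
    by (rule uniform_limit_dx_dy[OF C2(1)[OF C3(1)] C2(1)[OF C3(2)] lim lim_lap that]; assumption)+
  have d_lap: "dx (lap f) z = c * (2 * dx f z * exp (2 * f z) - (2 * inner (z^3 + b) (3 * z^2) * exp (- 2 * f z)
        - (norm (z^3 + b))\<^sup>2 * (2 * dx f z * exp (- 2 * f z))))"
    "dy (lap f) z = c * (2 * dy f z * exp (2 * f z) - (2 * inner (z^3 + b) (3 * z^2 * \<i>) * exp (- 2 * f z)
        - (norm (z^3 + b))\<^sup>2 * (2 * dy f z * exp (- 2 * f z))))"
    if f: "Ck_on 3 f UNIV"
      and lapf: "\<And>z. lap f z = c * (exp (2 * f z) - (norm (z^3 + b))\<^sup>2 * exp (- 2 * f z))" for f b z
  proof -
    \<comment> \<open>The squared norm is written as an inner product, to which the product rule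
      applies also at the zeros of z^3 + b.\<close>
    have "((\<lambda>z. c * (exp (2 * f z) - (inner (z^3 + b) (z^3 + b)) * exp (- 2 * f z))) has_derivative
        (\<lambda>w. c * (2 * (Re w *\<^sub>R dx f z + Im w *\<^sub>R dy f z) * exp (2 * f z)
          - (2 * inner (z^3 + b) (3 * z^2 * w) * exp (- 2 * f z)
            - inner (z^3 + b) (z^3 + b) * (2 * (Re w *\<^sub>R dx f z + Im w *\<^sub>R dy f z) * exp (- 2 * f z)))))) (at z)"
      by (rule derivative_eq_intros has_derivative_dx_dy diff f refl)+
         (auto simp: fun_eq_iff algebra_simps inner_commute)
    from dx_dy_eq[OF this] show
      "dx (lap f) z = c * (2 * dx f z * exp (2 * f z) - (2 * inner (z^3 + b) (3 * z^2) * exp (- 2 * f z)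
        - (norm (z^3 + b))\<^sup>2 * (2 * dx f z * exp (- 2 * f z))))"
      "dy (lap f) z = c * (2 * dy f z * exp (2 * f z) - (2 * inner (z^3 + b) (3 * z^2 * \<i>) * exp (- 2 * f z)
        - (norm (z^3 + b))\<^sup>2 * (2 * dy f z * exp (- 2 * f z))))"
      by (simp_all add: lapf[abs_def] power2_norm_eq_inner)
  qed
  have lim_d_lap: "uniform_limit K (\<lambda>j. dx (lap (W j))) (dx (lap W0)) sequentially"
    "uniform_limit K (\<lambda>j. dy (lap (W j))) (dy (lap W0)) sequentially" if "compact K" for K
  proof -
    \<comment> \<open>The argument \<open>e\<close> is the direction of differentiation, 1 or \<i>,
      and w' stands for the derivative of the solution in that direction.\<close>
    define H :: "complex \<Rightarrow> complex \<times> complex \<times> real \<times> real \<Rightarrow> real" where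
      "H e = (\<lambda>(u, z, w, w'). c * (2 * w' * exp (2 * w) - (2 * inner (z^3 + u) (3 * z^2 * e) * exp (- 2 * w)
        - (norm (z^3 + u))\<^sup>2 * (2 * w' * exp (- 2 * w)))))" for e
    have "continuous_on UNIV (H e)" for e
      unfolding H_def by (auto intro!: continuous_intros simp: case_prod_beta)
    moreover have "bounded ((\<lambda>z. (a, z, W0 z, dx W0 z)) ` K)" "bounded ((\<lambda>z. (a, z, W0 z, dy W0 z)) ` K)"
      by (intro bounded that continuous_intros cont C3)+
    ultimately have
      "uniform_limit K (\<lambda>j z. H 1 (v j, z, W j z, dx (W j) z)) (\<lambda>z. H 1 (a, z, W0 z, dx W0 z)) sequentially"
      "uniform_limit K (\<lambda>j z. H \<i> (v j, z, W j z, dy (W j) z)) (\<lambda>z. H \<i> (a, z, W0 z, dy W0 z)) sequentially"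
      using uniform_limit_compose_bounded[OF uniform_limit_Pair[OF uniform_limit_param[OF v]
              uniform_limit_Pair[OF id uniform_limit_Pair[OF lim[OF that] lim1(1)[OF that]]]], of "H 1"]
        uniform_limit_compose_bounded[OF uniform_limit_Pair[OF uniform_limit_param[OF v]
              uniform_limit_Pair[OF id uniform_limit_Pair[OF lim[OF that] lim1(2)[OF that]]]], of "H \<i>"]
      by blast+
    then show "uniform_limit K (\<lambda>j. dx (lap (W j))) (dx (lap W0)) sequentially"
      "uniform_limit K (\<lambda>j. dy (lap (W j))) (dy (lap W0)) sequentially"
      by (simp_all add: H_def d_lap[OF C3(1) lap(1), abs_def] d_lap[OF C3(2) lap(2), abs_def])
  qed
  have lim_lap_d: "uniform_limit K (\<lambda>j. lap (dx (W j))) (lap (dx W0)) sequentially"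
    "uniform_limit K (\<lambda>j. lap (dy (W j))) (lap (dy W0)) sequentially" if "compact K" for K
    using lim_d_lap[OF that] by (simp_all add: lap_dx_dy_commute[OF C3(1), abs_def] lap_dx_dy_commute[OF C3(2), abs_def])
  have lim2: "uniform_limit K (\<lambda>j. dx (dx (W j))) (dx (dx W0)) sequentially"
    "uniform_limit K (\<lambda>j. dy (dx (W j))) (dy (dx W0)) sequentially"
    by (rule uniform_limit_dx_dy[OF C2(2)[OF C3(1)] C2(2)[OF C3(2)] lim1(1) lim_lap_d(1) \<open>compact K\<close>];
        assumption)+
  have lim3: "uniform_limit K (\<lambda>j. dx (dy (W j))) (dx (dy W0)) sequentially"
    "uniform_limit K (\<lambda>j. dy (dy (W j))) (dy (dy W0)) sequentially"
    by (rule uniform_limit_dx_dy[OF C2(3)[OF C3(1)] C2(3)[OF C3(2)] lim1(2) lim_lap_d(2) \<open>compact K\<close>];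
        assumption)+
  show ?thesis
    using D lim[OF \<open>compact K\<close>] lim1[OF \<open>compact K\<close>] lim2 lim3 by auto
qed

section \<open>Differential operators of order at most two\<close>

abbreviation C2_operators :: "((complex \<Rightarrow> real) \<Rightarrow> complex \<Rightarrow> real) set" where
  "C2_operators \<equiv> {id, dx, dy, dx \<circ> dx, dx \<circ> dy, dy \<circ> dx, dy \<circ> dy}"

text \<open>Agreement of \<open>p\<close> with the combination is asked only on an open set, because
  \<open>\<psi> u\<close> is prescribed only off the zeros of z^3 + u.\<close>

lemma C2_operators_linear:
  fixes f g p :: "complex \<Rightarrow> real"
  assumes "open U" "z \<in> U" and C2: "Ck_on 2 f U" "Ck_on 2 g U"
    and p: "\<And>w. w \<in> U \<Longrightarrow> p w = f w - c * g w" and D: "D \<in> C2_operators"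
  shows "D p z = D f z - c * D g z"
proof -
  have cg: "Ck_on 2 (\<lambda>w. c * g w) U"
    by (intro Ck_on_mult Ck_on_const assms(1) C2)
  have diff: "h differentiable (at w)" if "Ck_on 2 h U" "w \<in> U" for h :: "complex \<Rightarrow> real" and w
    using that by (auto simp: numeral_2_eq_2)
  have first: "dx p w = dx (\<lambda>w. f w - c * g w) w" "dy p w = dy (\<lambda>w. f w - c * g w) w" if "w \<in> U" for w
    by (rule dx_dy_cong_open[OF assms(1) that p]; assumption)+
  have second: "dx (dx p) z = dx (dx (\<lambda>w. f w - c * g w)) z" "dx (dy p) z = dx (dy (\<lambda>w. f w - c * g w)) z"
    "dy (dx p) z = dy (dx (\<lambda>w. f w - c * g w)) z" "dy (dy p) z = dy (dy (\<lambda>w. f w - c * g w)) z"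
    by (rule dx_dy_cong_open[OF assms(1,2)]; simp add: first)+
  show ?thesis
    using D by (auto simp: p[OF assms(2)] first[OF assms(2)] second
        dx_dy_diff[OF diff[OF C2(1) assms(2)] diff[OF cg assms(2)]] dx_dy_cmult[OF diff[OF C2(2) assms(2)]]
        second_diff[OF assms(1,2) C2(1) cg] second_cmult[OF assms(1,2) C2(2)])
qed

section \<open>The explicit summand ln |z^3 + u|\<close>

lemma open_nonzeros: "open {z::complex. z^3 + u \<noteq> 0}"
  by (intro open_Collect_neq continuous_intros)

text \<open>Writing out the logarithmic derivative and its derivative as rational functions of (u,
  z) makes the dependence on the parameter visible.\<close>

lemma ln_norm_cubic:
  fixes u z :: complex
  defines "L \<equiv> \<lambda>w. ln (norm (w^3 + u))" and "U \<equiv> {w. w^3 + u \<noteq> 0}"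
  shows "Ck_on k L U"
    and "z \<in> U \<Longrightarrow> lap L z = 0"
    and "z \<in> U \<Longrightarrow> dx L z = Re (3 * z^2 / (z^3 + u))"
    and "z \<in> U \<Longrightarrow> dy L z = Re (\<i> * (3 * z^2 / (z^3 + u)))"
    and "z \<in> U \<Longrightarrow> dx (dx L) z = Re (6 * z / (z^3 + u) - 9 * z^4 / (z^3 + u)^2)"
    and "z \<in> U \<Longrightarrow> dx (dy L) z = Re (\<i> * (6 * z / (z^3 + u) - 9 * z^4 / (z^3 + u)^2))"
    and "z \<in> U \<Longrightarrow> dy (dx L) z = Re (\<i> * (6 * z / (z^3 + u) - 9 * z^4 / (z^3 + u)^2))"
    and "z \<in> U \<Longrightarrow> dy (dy L) z = - Re (6 * z / (z^3 + u) - 9 * z^4 / (z^3 + u)^2)"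
proof -
  have "open U"
    unfolding U_def by (rule open_nonzeros)
  have holo: "(\<lambda>w. w^3 + u) holomorphic_on U"
    by (intro holomorphic_intros)
  have d: "deriv (\<lambda>w. w^3 + u) = (\<lambda>w. 3 * w^2)"
    by (intro ext DERIV_imp_deriv) (auto intro!: derivative_eq_intros)
  have dd: "deriv (\<lambda>w. 3 * w^2 / (w^3 + u)) z = 6 * z / (z^3 + u) - 9 * z^4 / (z^3 + u)^2" if "z \<in> U"
  proof (rule DERIV_imp_deriv)
    have "((\<lambda>w. 3 * w^2) has_field_derivative 6 * z) (at z)"
      "((\<lambda>w. w^3 + u) has_field_derivative 3 * z^2) (at z)"
      by (auto intro!: derivative_eq_intros)
    from DERIV_divide[OF this] that
    have "((\<lambda>w. 3 * w^2 / (w^3 + u)) has_field_derivative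
        (6 * z * (z^3 + u) - 3 * z^2 * (3 * z^2)) / ((z^3 + u) * (z^3 + u))) (at z)"
      by (simp add: U_def)
    also have "(6 * z * (z^3 + u) - 3 * z^2 * (3 * z^2)) / ((z^3 + u) * (z^3 + u))
        = 6 * z / (z^3 + u) - 9 * z^4 / (z^3 + u)^2"
      using that by (simp add: U_def diff_divide_distrib power2_eq_square power4_eq_xxxx)
    finally show "((\<lambda>w. 3 * w^2 / (w^3 + u)) has_field_derivative
        6 * z / (z^3 + u) - 9 * z^4 / (z^3 + u)^2) (at z)" .
  qed
  note * = ln_norm_holomorphic[OF \<open>open U\<close> holo, folded L_def, unfolded d]
  show "Ck_on k L U"
    by (rule *) (simp add: U_def)
  assume z: "z \<in> U"
  show "lap L z = 0" "dx L z = Re (3 * z^2 / (z^3 + u))" "dy L z = Re (\<i> * (3 * z^2 / (z^3 + u)))"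
    by (rule *(2-)[OF _ z]; simp add: U_def)+
  show "dx (dx L) z = Re (6 * z / (z^3 + u) - 9 * z^4 / (z^3 + u)^2)"
    "dx (dy L) z = Re (\<i> * (6 * z / (z^3 + u) - 9 * z^4 / (z^3 + u)^2))"
    "dy (dx L) z = Re (\<i> * (6 * z / (z^3 + u) - 9 * z^4 / (z^3 + u)^2))"
    "dy (dy L) z = - Re (6 * z / (z^3 + u) - 9 * z^4 / (z^3 + u)^2)"
    unfolding dd[OF z, symmetric] by (rule *(2-)[OF _ z]; simp add: U_def)+
qed

text \<open>The point is the joint continuity in (u, z), from which locally uniform convergence in u
  follows by compactness.\<close>

lemma C2_operators_ln_norm_cubic:
  assumes "D \<in> C2_operators"
  shows "\<exists>F. continuous_on {p. snd p ^ 3 + fst p \<noteq> 0} F \<and>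
    (\<forall>u z. z^3 + u \<noteq> 0 \<longrightarrow> D (\<lambda>w. ln (norm (w^3 + u))) z = F (u, z))"
proof -
  have witness: ?thesis
    if "continuous_on {p. snd p ^ 3 + fst p \<noteq> 0} F"
      "\<And>u z. z^3 + u \<noteq> 0 \<Longrightarrow> D (\<lambda>w. ln (norm (w^3 + u))) z = F (u, z)" for F
    using that by blast
  define P :: "complex \<times> complex \<Rightarrow> complex" where "P p = snd p ^ 3 + fst p" for p
  define Q :: "complex \<times> complex \<Rightarrow> complex" where
    "Q p = 6 * snd p / P p - 9 * snd p ^ 4 / P p ^ 2" for p
  have cont: "continuous_on {p. P p \<noteq> 0} P" "continuous_on {p. P p \<noteq> 0} Q"
    unfolding P_def Q_def by (auto intro!: continuous_intros)
  note eqs = ln_norm_cubic(3-8)[unfolded mem_Collect_eq]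
  consider "D = id" | "D = dx" | "D = dy" | "D = dx \<circ> dx" | "D = dx \<circ> dy" | "D = dy \<circ> dx" | "D = dy \<circ> dy"
    using assms by blast
  then show ?thesis
  proof cases
    case 1
    show ?thesis
      by (rule witness[of "\<lambda>p. ln (norm (P p))"], fold P_def)
         (use cont in \<open>auto intro!: continuous_intros simp: 1\<close>, simp add: P_def)
  next
    case 2
    show ?thesis
      by (rule witness[of "\<lambda>p. Re (3 * snd p ^ 2 / P p)"], fold P_def)
         (use cont in \<open>auto intro!: continuous_intros simp: 2 eqs\<close>, simp add: P_def)
  next
    case 3
    show ?thesis
      by (rule witness[of "\<lambda>p. Re (\<i> * (3 * snd p ^ 2 / P p))"], fold P_def)
         (use cont in \<open>auto intro!: continuous_intros simp: 3 eqs\<close>, simp add: P_def)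
  next
    case 4
    show ?thesis
      by (rule witness[of "\<lambda>p. Re (Q p)"], fold P_def)
         (use cont in \<open>auto intro!: continuous_intros simp: 4 eqs\<close>, simp add: P_def Q_def)
  next
    case 5
    show ?thesis
      by (rule witness[of "\<lambda>p. Re (\<i> * Q p)"], fold P_def)
         (use cont in \<open>auto intro!: continuous_intros simp: 5 eqs\<close>, simp add: P_def Q_def)
  next
    case 6
    show ?thesis
      by (rule witness[of "\<lambda>p. Re (\<i> * Q p)"], fold P_def)
         (use cont in \<open>auto intro!: continuous_intros simp: 6 eqs\<close>, simp add: P_def Q_def)
  next
    case 7
    show ?thesis
      by (rule witness[of "\<lambda>p. - Re (Q p)"], fold P_def)
         (use cont in \<open>auto intro!: continuous_intros simp: 7 eqs\<close>, simp add: P_def Q_def)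
  qed
qed

text \<open>With \<open>d\<close> a lower bound for |z| on \<Omega>, the modulus |z|^3 \<ge> d^3
  exceeds |u| once |u| \<le> d^3 / 2. The non-strict bound on |u| provides a closed, hence compact,
  disc of parameters.\<close>

lemma nonzero_near_compact:
  assumes "compact \<Omega>" "0 \<notin> \<Omega>"
  shows "\<exists>r>0. \<forall>u. norm u \<le> r \<longrightarrow> (\<forall>z\<in>\<Omega>. z^3 + u \<noteq> (0::complex))"
proof -
  obtain d where "d > 0" and d: "\<And>z. z \<in> \<Omega> \<Longrightarrow> d \<le> norm z"
    using separate_point_closed[OF compact_imp_closed[OF assms(1)] assms(2)] by (auto simp: dist_norm)
  have "z^3 + u \<noteq> 0" if "norm u \<le> d^3 / 2" "z \<in> \<Omega>" for u z
  proof
    assume "z^3 + u = 0"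
    then have "norm (z^3) = norm u"
      by (metis add_eq_0_iff norm_minus_cancel)
    moreover have "d^3 \<le> norm (z^3)"
      using d[OF that(2)] \<open>d > 0\<close> by (simp add: norm_power power_mono)
    moreover have "d^3 > 0"
      using \<open>d > 0\<close> by simp
    ultimately show False
      using that(1) by simp
  qed
  then show ?thesis
    using \<open>d > 0\<close> by (intro exI[of _ "d^3 / 2"]) auto
qed

text \<open>A function jointly continuous on the compact product of a parameter disc and \<Omega> is
  uniformly continuous there. The limit is kept as \<open>w^3 + 0\<close>, the member u = 0 of the
  family.\<close>

lemma ln_norm_cubic_C2_convergence:
  assumes "compact \<Omega>" "0 \<notin> \<Omega>" "v \<longlonglongrightarrow> 0" "D \<in> C2_operators"
  shows "uniform_limit \<Omega> (\<lambda>j. D (\<lambda>w. ln (norm (w^3 + v j)))) (D (\<lambda>w. ln (norm (w^3 + 0)))) sequentially"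
proof -
  obtain F where cont: "continuous_on {p. snd p ^ 3 + fst p \<noteq> 0} F"
    and F: "\<And>u z. z^3 + u \<noteq> 0 \<Longrightarrow> D (\<lambda>w. ln (norm (w^3 + u))) z = F (u, z)"
    using C2_operators_ln_norm_cubic[OF assms(4)] by blast
  obtain r where "r > 0" and r: "\<And>u z. norm u \<le> r \<Longrightarrow> z \<in> \<Omega> \<Longrightarrow> z^3 + u \<noteq> 0"
    using nonzero_near_compact[OF assms(1,2)] by blast
  have ev: "\<forall>\<^sub>F j in sequentially. norm (v j) \<le> r"
    using tendstoD[OF assms(3) \<open>r > 0\<close>] by eventually_elim simp
  have "uniform_limit \<Omega> (\<lambda>j z. F (v j, z)) (\<lambda>z. F (0, z)) sequentially"
  proof (rule uniform_limit_compose_compact[where F = F and q = "\<lambda>j z. (v j, z)"])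
    show "uniform_limit \<Omega> (\<lambda>j z. (v j, z)) (\<lambda>z. (0, z)) sequentially"
      by (intro uniform_limit_Pair uniform_limit_param assms(3)) (simp add: uniform_limit_iff)
    show "compact (cball (0::complex) r \<times> \<Omega>)"
      by (intro compact_Times assms(1) compact_cball)
    show "continuous_on (cball 0 r \<times> \<Omega>) F"
      by (rule continuous_on_subset[OF cont]) (auto dest: r)
    show "\<forall>\<^sub>F j in sequentially. \<forall>z\<in>\<Omega>. (v j, z) \<in> cball 0 r \<times> \<Omega>"
      using ev by eventually_elim simp
  qed
  moreover have "\<forall>\<^sub>F j in sequentially. \<forall>z\<in>\<Omega>. D (\<lambda>w. ln (norm (w^3 + v j))) z = F (v j, z)"
    using ev by eventually_elim (use F r in blast)
  moreover have "\<forall>z\<in>\<Omega>. D (\<lambda>w. ln (norm (w^3 + 0))) z = F (0, z)"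
    by (intro ballI F r) (use \<open>r > 0\<close> in auto)
  ultimately show ?thesis
    by (simp only: uniform_limit_cong)
qed

text \<open>Both normalisations of Hitchin's equation are treated at once: the factor 8 \<kappa> is
  8 or 2.\<close>

theorem theorem3p4:
  fixes \<kappa> :: real
    and h :: "complex \<Rightarrow> complex \<Rightarrow> complex^2^2"
    and \<psi> :: "complex \<Rightarrow> complex \<Rightarrow> real"
  assumes "\<kappa> = 1 \<or> \<kappa> = 1/4"
    and "\<And>u. harmonic_metric \<kappa> weights (higgs_field u) (h u)"
    and "\<And>u z. z^3 + u \<noteq> 0 \<Longrightarrow>
           h u z = mat2 (of_real (norm (z^3 + u) powr (1/2) * exp (\<psi> u z))) 0
                        0 (of_real (norm (z^3 + u) powr (-1/2) * exp (- \<psi> u z)))"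
  shows "(\<forall>u z. z^3 + u \<noteq> 0 \<longrightarrow>
            laplacian (\<lambda>w. of_real (\<psi> u w)) z
              = of_real (8 * \<kappa> * norm (z^3 + u) * sinh (2 * \<psi> u z))) \<and>
         (\<exists>v :: nat \<Rightarrow> complex. (\<forall>j. v j \<noteq> 0) \<and> v \<longlonglongrightarrow> 0 \<and>
            (\<forall>\<Omega>. compact \<Omega> \<and> 0 \<notin> \<Omega> \<longrightarrow> C2_converges \<Omega> (\<lambda>j. \<psi> (v j)) (\<psi> 0)))"
proof -
  define W where "W u z = ln (Re (h u z $ 1 $ 1))" for u z
  define L where "L u z = ln (norm (z^3 + u))" for u z :: complex
  define U where "U u = {z::complex. z^3 + u \<noteq> 0}" for u
  have "open (U u)" for u
    unfolding U_def by (rule open_nonzeros)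
  have \<psi>: "\<psi> u z = W u z - 1/2 * L u z" if "z \<in> U u" for u z
    using harmonic_psi[OF assms(2,3)] that unfolding W_def L_def U_def by simp
  have Ck: "Ck_on k (W u) V" for k u V
    using Ck_on_subset[OF harmonic_Ck[OF assms(2,3)]] unfolding W_def by simp
  have lap: "lap (W u) z = 4 * \<kappa> * (exp (2 * W u z) - (norm (z^3 + u))\<^sup>2 * exp (- 2 * W u z))" for u z
    using harmonic_lap[OF assms(2,3)] unfolding W_def by simp
  have growth: "\<forall>\<^sub>F z in at_infinity. \<bar>W u z - 3/2 * ln (norm z)\<bar> \<le> \<epsilon> * ln (norm z)" if "\<epsilon> > 0" for u \<epsilon>
    using harmonic_growth[OF assms(2,3) that] unfolding W_def by simp
  have L: "Ck_on k (L u) (U u)" "z \<in> U u \<Longrightarrow> lap (L u) z = 0" for k u z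
    unfolding L_def U_def using ln_norm_cubic by blast+
  have \<psi>_ops: "D (\<psi> u) z = D (W u) z - 1/2 * D (L u) z" if "z \<in> U u" "D \<in> C2_operators" for D u z
    by (rule C2_operators_linear[OF \<open>open (U u)\<close> that(1) Ck L(1) \<psi> that(2)])
  have \<psi>_C2: "Ck_on 2 (\<psi> u) (U u)" for u
  proof (rule Ck_on_cong_open[OF \<open>open (U u)\<close>])
    show "Ck_on 2 (\<lambda>z. W u z - 1/2 * L u z) (U u)"
      by (intro Ck_on_diff Ck_on_mult Ck_on_const Ck L \<open>open (U u)\<close>)
  qed (simp add: \<psi>)
  have "laplacian (\<lambda>w. of_real (\<psi> u w)) z = of_real (8 * \<kappa> * norm (z^3 + u) * sinh (2 * \<psi> u z))"
    if "z^3 + u \<noteq> 0" for u z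
  proof -
    have z: "z \<in> U u"
      using that by (simp add: U_def)
    define n where "n = norm (z^3 + u)"
    have "n > 0"
      using that by (simp add: n_def)
    \<comment> \<open>The logarithmic summand is harmonic off the zeros.\<close>
    have "lap (\<psi> u) z = lap (W u) z"
      using L(2)[OF z] \<psi>_ops[OF z, of "dx \<circ> dx"] \<psi>_ops[OF z, of "dy \<circ> dy"] by (simp add: lap_def)
    also have "\<dots> = 4 * \<kappa> * (exp (2 * W u z) - n\<^sup>2 * exp (- 2 * W u z))"
      unfolding lap n_def ..
    finally have lap_psi: "lap (\<psi> u) z = 4 * \<kappa> * (exp (2 * W u z) - n\<^sup>2 * exp (- 2 * W u z))" .
    have "2 * W u z = 2 * \<psi> u z + ln n"
      using \<psi>[OF z] by (simp add: L_def n_def)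
    then have "exp (2 * W u z) = n * exp (2 * \<psi> u z)" "exp (- 2 * W u z) = exp (- 2 * \<psi> u z) / n"
      using \<open>n > 0\<close> by (simp_all add: exp_add exp_diff exp_minus divide_inverse)
    then have "4 * \<kappa> * (exp (2 * W u z) - n\<^sup>2 * exp (- 2 * W u z))
        = 4 * \<kappa> * (n * exp (2 * \<psi> u z) - n\<^sup>2 * (exp (- 2 * \<psi> u z) / n))"
      by (simp only:)
    also have "\<dots> = 8 * \<kappa> * n * sinh (2 * \<psi> u z)"
      using \<open>n > 0\<close> by (simp add: sinh_field_def power2_eq_square right_diff_distrib)
    finally have "lap (\<psi> u) z = 8 * \<kappa> * n * sinh (2 * \<psi> u z)"
      using lap_psi by simp
    then show ?thesis
      by (simp add: laplacian_of_real[OF \<open>open (U u)\<close> z \<psi>_C2] n_def)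
  qed
  \<comment> \<open>The estimates hold for the whole family as u tends to 0, so this null sequence
    is an arbitrary choice.\<close>
  moreover define v :: "nat \<Rightarrow> complex" where "v j = of_real (inverse (real (Suc j)))" for j
  have "v \<longlonglongrightarrow> 0"
    unfolding v_def using tendsto_of_real[OF LIMSEQ_inverse_real_of_nat, where 'a = complex] by simp
  have "v j \<noteq> 0" for j
    by (simp add: v_def del: of_nat_Suc)
  have "\<kappa> > 0"
    using assms(1) by auto
  \<comment> \<open>The set \<open>K\<close> is arbitrary: the convergence of \<open>W\<close> is
    uniform on the whole plane, and only the derivatives need compact sets.\<close>
  have lim: "uniform_limit K (\<lambda>j. W (v j)) (W 0) sequentially" for K
  proof (rule uniform_limitI)
    fix e :: real assume "e > 0"
    obtain m where m: "m > 0" "\<And>z. m \<le> exp (2 * W 0 z)"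
      using exp_ge_positive_of_growth[of "W 0"] growth[of 1 0] Ck[of 0 0] by auto
    have "(1 - exp (- 2 * (e / 2))) * m > 0"
      using \<open>e > 0\<close> m by simp
    from tendstoD[OF \<open>v \<longlonglongrightarrow> 0\<close> this]
    show "\<forall>\<^sub>F j in sequentially. \<forall>z\<in>K. dist (W (v j) z) (W 0 z) < e"
    proof eventually_elim
      case (elim j)
      have "\<bar>W (v j) z - W 0 z\<bar> \<le> e / 2" for z
      proof (rule sup_norm_estimate[OF Ck Ck _ _ _ _ _ _ lap lap _ m, where s = "norm (v j)"])
        show "\<bar>norm (z^3 + v j) - norm (z^3 + 0)\<bar> \<le> norm (v j)" for z
          using norm_triangle_ineq3[of "z^3 + v j" "z^3"] by simp
        show "\<forall>\<^sub>F z in at_infinity. \<bar>W (v j) z - W 0 z\<bar> \<le> \<epsilon> * ln (norm z)" if "\<epsilon> > 0" for \<epsilon>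
        proof -
          have "\<epsilon> / 2 > 0"
            using that by simp
          from growth[OF this, of "v j"] growth[OF this, of 0] show ?thesis
          proof eventually_elim
            case (elim z)
            have "\<bar>W (v j) z - W 0 z\<bar>
                \<le> \<bar>W (v j) z - 3/2 * ln (norm z)\<bar> + \<bar>W 0 z - 3/2 * ln (norm z)\<bar>"
              using abs_triangle_ineq4[of "W (v j) z - 3/2 * ln (norm z)" "W 0 z - 3/2 * ln (norm z)"]
              by simp
            also have "\<dots> \<le> \<epsilon> / 2 * ln (norm z) + \<epsilon> / 2 * ln (norm z)"
              by (rule add_mono[OF elim])
            finally show ?case
              by simp
          qed
        qed
        show "norm (v j) \<le> (1 - exp (- 2 * (e / 2))) * m"
          using elim by simp
      qed (use \<open>\<kappa> > 0\<close> \<open>e > 0\<close> in simp_all)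
      moreover have "e / 2 < e"
        using \<open>e > 0\<close> by simp
      ultimately show ?case
        unfolding dist_real_def by (blast intro: le_less_trans)
    qed
  qed
  have "C2_converges \<Omega> (\<lambda>j. \<psi> (v j)) (\<psi> 0)" if "compact \<Omega>" "0 \<notin> \<Omega>" for \<Omega>
  proof -
    obtain r where "r > 0" and r: "\<And>u. norm u \<le> r \<Longrightarrow> \<Omega> \<subseteq> U u"
      using nonzero_near_compact[OF \<open>compact \<Omega>\<close> \<open>0 \<notin> \<Omega>\<close>] unfolding U_def by blast
    \<comment> \<open>For small \<open>j\<close> a zero of z^3 + v j may lie in \<Omega>, so
      regularity there is available only eventually.\<close>
    have ev: "\<forall>\<^sub>F j in sequentially. \<Omega> \<subseteq> U (v j)"
      using tendstoD[OF \<open>v \<longlonglongrightarrow> 0\<close> \<open>r > 0\<close>] by eventually_elim (simp add: r)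
    have "\<Omega> \<subseteq> U 0"
      using r[of 0] \<open>r > 0\<close> by simp
    have near: "C2_near \<Omega> (\<psi> u)" if "\<Omega> \<subseteq> U u" for u
      unfolding C2_near_def using that \<psi>_C2 \<open>open (U u)\<close> by blast
    have "uniform_limit \<Omega> (\<lambda>j. D (\<psi> (v j))) (D (\<psi> 0)) sequentially" if D: "D \<in> C2_operators" for D
    proof -
      have "uniform_limit \<Omega> (\<lambda>j. D (W (v j))) (D (W 0)) sequentially"
        by (rule sinh_Gordon_C2_convergence[OF Ck Ck lap lap \<open>v \<longlonglongrightarrow> 0\<close> lim \<open>compact \<Omega>\<close> D])
      moreover have "uniform_limit \<Omega> (\<lambda>j. D (L (v j))) (D (L 0)) sequentially"
        using ln_norm_cubic_C2_convergence[OF \<open>compact \<Omega>\<close> \<open>0 \<notin> \<Omega>\<close> \<open>v \<longlonglongrightarrow> 0\<close> D] unfolding L_def .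
      ultimately have "uniform_limit \<Omega> (\<lambda>j z. D (W (v j)) z - 1/2 * D (L (v j)) z)
          (\<lambda>z. D (W 0) z - 1/2 * D (L 0) z) sequentially"
        by (intro uniform_limit_intros)
      moreover have "\<forall>\<^sub>F j in sequentially. \<forall>z\<in>\<Omega>. D (\<psi> (v j)) z = D (W (v j)) z - 1/2 * D (L (v j)) z"
        using ev by eventually_elim (use \<psi>_ops D in blast)
      moreover have "\<forall>z\<in>\<Omega>. D (\<psi> 0) z = D (W 0) z - 1/2 * D (L 0) z"
        using \<psi>_ops D \<open>\<Omega> \<subseteq> U 0\<close> by blast
      ultimately show ?thesis
        by (simp only: uniform_limit_cong)
    qed
    then show ?thesis
      unfolding C2_converges_def using near[OF \<open>\<Omega> \<subseteq> U 0\<close>] ev by (auto elim!: eventually_mono intro: near)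
  qed
  ultimately show ?thesis
    using \<open>v \<longlonglongrightarrow> 0\<close> \<open>\<And>j. v j \<noteq> 0\<close> by blast
qed

end
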